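(* Let $\mathbf q=(q_{ij})$ be a complex $n\times n$ matrix with $q_{ii}=q_{ij}q_{ji}=1$ for all $i,j$, let $V$ have basis $x_1,\dots,x_n$, let $\mathcal C_1,\dots,\mathcal C_n$ be finite subgroups of $\mathbb C^\times$, and let $c_{i,\varepsilon}\in\mathbb C$ for $1\le i\le n$, $\varepsilon\in\mathcal C_i\setminus\{1\}$. Define operators on $S_{\mathbf q}(V)$ by $$\underline\nabla_i=\underline\partial_i+\sum_{\varepsilon\in\mathcal C_i\setminus\{1\}}\frac{c_{i,\varepsilon}}{1-\varepsilon}\cdot\frac1{x_i}(1-t_i^{(\varepsilon)}),\qquad i=1,\dots,n.$$ Then for all $i,j$, as operators on $S_{\mathbf q}(V)$ (with $x_j$ acting by left multiplication), $$\underline\nabla_ix_j-q_{ji}x_j\underline\nabla_i=\delta_{ij}\Bigl(1+\sum_{\varepsilon\in\mathcal C_i\setminus\{1\}}c_{i,\varepsilon}t_i^{(\varepsilon)}\Bigr),\qquad\underline\nabla_i\underline\nabla_j=q_{ij}\underline\nabla_j\underline\nabla_i.$$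
   Context: $S_{\mathbf q}(V)=\mathbb C\langle x_1,\dots,x_n\mid x_ix_j=q_{ij}x_jx_i\rangle$. The braided partial derivative is $\underline\partial_i(x_1^{a_1}\cdots x_n^{a_n})=a_i\,q_{1,i}^{a_1}\cdots q_{i-1,i}^{a_{i-1}}\,x_1^{a_1}\cdots x_i^{a_i-1}\cdots x_n^{a_n}$. $t_i^{(\varepsilon)}$ is the algebra automorphism of $S_{\mathbf q}(V)$ with $x_i\mapsto\varepsilon x_i$ and $x_k\mapsto x_k$ for $k\neq i$. $\frac1{x_i}$ denotes left multiplication by $x_i^{-1}$ in the skew-field of fractions; $\frac1{x_i}(1-t_i^{(\varepsilon)})$ maps $S_{\mathbf q}(V)$ to itself. *)

theory Defs
  imports Complex_Main "HOL-Library.Poly_Mapping" "HOL-Algebra.QuotRing"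
begin

section \<open>The free algebra\<close>

text \<open>Words form the free monoid, written additively so that finitely supported functions on
  words carry the convolution product of \<^theory>\<open>HOL-Library.Poly_Mapping\<close>, i.e. form the monoid
  algebra \<open>\<complex>\<langle>x\<^sub>0, x\<^sub>1, \<dots>\<rangle>\<close>.\<close>

datatype word = Word (letters: "nat list")

instantiation word :: monoid_add
begin

definition zero_word :: word where "0 = Word []"

definition plus_word :: "word \<Rightarrow> word \<Rightarrow> word" where "u + v = Word (letters u @ letters v)"

instance
  by standard (simp_all add: zero_word_def plus_word_def)

end

type_synonym ncpoly = "word \<Rightarrow>\<^sub>0 complex"

definition fvar :: "nat \<Rightarrow> ncpoly" where
  "fvar i = Poly_Mapping.single (Word [i]) 1"

definition fconst :: "complex \<Rightarrow> ncpoly" where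
  "fconst z = Poly_Mapping.single 0 z"

definition free_algebra :: "nat \<Rightarrow> ncpoly ring" where
  "free_algebra n =
    \<lparr>carrier = {p. \<forall>w \<in> Poly_Mapping.keys p. set (letters w) \<subseteq> {1..n}},
     monoid.mult = (*), one = 1, zero = 0, add = (+)\<rparr>"

lemma in_free_algebra_iff:
  "p \<in> carrier (free_algebra n) \<longleftrightarrow> (\<forall>w \<in> Poly_Mapping.keys p. set (letters w) \<subseteq> {1..n})"
  by (simp add: free_algebra_def)

lemma free_algebra_sel [simp]:
  "monoid.mult (free_algebra n) = (*)" "monoid.one (free_algebra n) = 1"
  "zero (free_algebra n) = 0" "add (free_algebra n) = (+)"
  by (simp_all add: free_algebra_def)

lemma free_algebra_add:
  assumes "p \<in> carrier (free_algebra n)" "r \<in> carrier (free_algebra n)"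
  shows "p + r \<in> carrier (free_algebra n)"
  using assms Poly_Mapping.keys_add[of p r] unfolding in_free_algebra_iff by blast

lemma free_algebra_uminus:
  "p \<in> carrier (free_algebra n) \<Longrightarrow> - p \<in> carrier (free_algebra n)"
  by (simp add: in_free_algebra_iff)

lemma free_algebra_diff:
  "p \<in> carrier (free_algebra n) \<Longrightarrow> r \<in> carrier (free_algebra n) \<Longrightarrow>
    p - r \<in> carrier (free_algebra n)"
  using free_algebra_add[OF _ free_algebra_uminus, of p n r] by simp

lemma free_algebra_mult:
  assumes "p \<in> carrier (free_algebra n)" "r \<in> carrier (free_algebra n)"
  shows "p * r \<in> carrier (free_algebra n)"
  unfolding in_free_algebra_iff
proof
  fix w assume "w \<in> Poly_Mapping.keys (p * r)"
  then obtain u v where "w = u + v" "u \<in> Poly_Mapping.keys p" "v \<in> Poly_Mapping.keys r"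
    using keys_mult by blast
  moreover from this have "set (letters u) \<subseteq> {1..n}" "set (letters v) \<subseteq> {1..n}"
    using assms unfolding in_free_algebra_iff by blast+
  ultimately show "set (letters w) \<subseteq> {1..n}"
    by (simp add: plus_word_def)
qed

lemma free_algebra_generators:
  "0 \<in> carrier (free_algebra n)" "1 \<in> carrier (free_algebra n)"
  "fconst z \<in> carrier (free_algebra n)"
  "i \<in> {1..n} \<Longrightarrow> fvar i \<in> carrier (free_algebra n)"
  by (simp_all add: in_free_algebra_iff fconst_def fvar_def zero_word_def)

lemma ring_free_algebra: "ring (free_algebra n)"
proof (rule ringI)
  have "\<exists>r \<in> carrier (free_algebra n). r + p = 0" if "p \<in> carrier (free_algebra n)" for p
    using free_algebra_uminus[OF that] by (intro bexI[of _ "- p"]) auto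
  then show "abelian_group (free_algebra n)"
    by (intro abelian_groupI)
      (simp_all add: add_ac free_algebra_add free_algebra_generators)
  show "monoid (free_algebra n)"
    by unfold_locales (simp_all add: mult.assoc free_algebra_mult free_algebra_generators)
qed (simp_all add: algebra_simps)


section \<open>The quantum symmetric algebra\<close>

definition q_relators :: "nat \<Rightarrow> (nat \<Rightarrow> nat \<Rightarrow> complex) \<Rightarrow> ncpoly set" where
  "q_relators n q =
    {fvar i * fvar j - fconst (q i j) * fvar j * fvar i | i j. i \<in> {1..n} \<and> j \<in> {1..n}}"

definition q_ideal :: "nat \<Rightarrow> (nat \<Rightarrow> nat \<Rightarrow> complex) \<Rightarrow> ncpoly set" where
  "q_ideal n q = Idl\<^bsub>free_algebra n\<^esub> (q_relators n q)"

lemma ideal_q_ideal: "ideal (q_ideal n q) (free_algebra n)"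
proof -
  have "q_relators n q \<subseteq> carrier (free_algebra n)"
    unfolding q_relators_def
    by (clarify, intro free_algebra_diff free_algebra_mult free_algebra_generators)
  then show ?thesis
    unfolding q_ideal_def by (rule ring.genideal_ideal[OF ring_free_algebra])
qed

definition q_sym :: "nat \<Rightarrow> (nat \<Rightarrow> nat \<Rightarrow> complex) \<Rightarrow> ncpoly set ring" where
  "q_sym n q = free_algebra n Quot q_ideal n q"

lemma ring_q_sym: "ring (q_sym n q)"
  unfolding q_sym_def by (rule ideal.quotient_is_ring[OF ideal_q_ideal])

definition q_var :: "nat \<Rightarrow> (nat \<Rightarrow> nat \<Rightarrow> complex) \<Rightarrow> nat \<Rightarrow> ncpoly set" where
  "q_var n q i = q_ideal n q +>\<^bsub>free_algebra n\<^esub> fvar i"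

text \<open>Scalars act through the structure map \<open>\<complex> \<rightarrow> S\<^sub>q(V)\<close>, whose image is central.\<close>

definition q_scale ::
  "nat \<Rightarrow> (nat \<Rightarrow> nat \<Rightarrow> complex) \<Rightarrow> complex \<Rightarrow> ncpoly set \<Rightarrow> ncpoly set" where
  "q_scale n q z f = (q_ideal n q +>\<^bsub>free_algebra n\<^esub> fconst z) \<otimes>\<^bsub>q_sym n q\<^esub> f"

text \<open>The ordered monomial \<open>x\<^sub>1\<^sup>a\<^sup>1 \<cdots> x\<^sub>n\<^sup>a\<^sup>n\<close>; only the values of \<open>a\<close> on \<open>{1..n}\<close> matter.\<close>

definition q_monom ::
  "nat \<Rightarrow> (nat \<Rightarrow> nat \<Rightarrow> complex) \<Rightarrow> (nat \<Rightarrow> nat) \<Rightarrow> ncpoly set" where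
  "q_monom n q a =
    foldr (\<otimes>\<^bsub>q_sym n q\<^esub>) (map (\<lambda>k. q_var n q k [^]\<^bsub>q_sym n q\<^esub> a k) [1..<Suc n]) \<one>\<^bsub>q_sym n q\<^esub>"

definition q_linear ::
  "nat \<Rightarrow> (nat \<Rightarrow> nat \<Rightarrow> complex) \<Rightarrow> (ncpoly set \<Rightarrow> ncpoly set) \<Rightarrow> bool" where
  "q_linear n q T \<longleftrightarrow>
    T \<in> carrier (q_sym n q) \<rightarrow> carrier (q_sym n q) \<and>
    (\<forall>f \<in> carrier (q_sym n q). \<forall>g \<in> carrier (q_sym n q).
       T (f \<oplus>\<^bsub>q_sym n q\<^esub> g) = T f \<oplus>\<^bsub>q_sym n q\<^esub> T g) \<and>
    (\<forall>z. \<forall>f \<in> carrier (q_sym n q). T (q_scale n q z f) = q_scale n q z (T f))"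


section \<open>Operators\<close>

text \<open>Operators given by their values on monomials or generators are specified by definite
  description; extensionality fixes their values outside the carrier, making them unique as
  functions on the whole type. For \<open>a i = 0\<close> the truncated exponent \<open>a i - 1\<close> is harmless, since
  the coefficient vanishes.\<close>

definition braided_deriv ::
  "nat \<Rightarrow> (nat \<Rightarrow> nat \<Rightarrow> complex) \<Rightarrow> nat \<Rightarrow> ncpoly set \<Rightarrow> ncpoly set" where
  "braided_deriv n q i = (THE D.
     D \<in> extensional (carrier (q_sym n q)) \<and> q_linear n q D \<and>
     (\<forall>a. D (q_monom n q a) =
        q_scale n q (of_nat (a i) * (\<Prod>k \<in> {1..<i}. q k i ^ a k))
          (q_monom n q (a(i := a i - 1)))))"

definition q_twist ::
  "nat \<Rightarrow> (nat \<Rightarrow> nat \<Rightarrow> complex) \<Rightarrow> nat \<Rightarrow> complex \<Rightarrow> ncpoly set \<Rightarrow> ncpoly set" where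
  "q_twist n q i \<epsilon> = (THE t.
     t \<in> extensional (carrier (q_sym n q)) \<and>
     t \<in> ring_iso (q_sym n q) (q_sym n q) \<and> q_linear n q t \<and>
     (\<forall>k \<in> {1..n}. t (q_var n q k) =
        (if k = i then q_scale n q \<epsilon> (q_var n q k) else q_var n q k)))"

text \<open>\<open>K\<close>, with the embedding \<open>\<iota>\<close>, is the skew field of (left) fractions of \<open>R\<close>. The equation for
  the units of \<open>K\<close> includes \<open>\<one> \<noteq> \<zero>\<close>, as \<open>\<one>\<close> is a unit.\<close>

definition skew_field_of_fractions ::
  "('a, 'c) ring_scheme \<Rightarrow> ('k, 'd) ring_scheme \<Rightarrow> ('a \<Rightarrow> 'k) \<Rightarrow> bool" where
  "skew_field_of_fractions R K \<iota> \<longleftrightarrow>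
    ring K \<and> Units K = carrier K - {\<zero>\<^bsub>K\<^esub>} \<and>
    \<iota> \<in> ring_hom R K \<and> inj_on \<iota> (carrier R) \<and>
    (\<forall>z \<in> carrier K. \<exists>a \<in> carrier R. \<exists>s \<in> carrier R - {\<zero>\<^bsub>R\<^esub>}.
       z = inv\<^bsub>K\<^esub> (\<iota> s) \<otimes>\<^bsub>K\<^esub> \<iota> a)"

text \<open>The operator \<open>(1/x\<^sub>i)(1 - t\<^sub>i)\<close> with parameter \<open>\<epsilon>\<close>: the product is formed in the skew field
  of fractions \<open>K\<close> and then read back in \<open>S\<^sub>q(V)\<close>.\<close>

definition q_divdiff ::
  "nat \<Rightarrow> (nat \<Rightarrow> nat \<Rightarrow> complex) \<Rightarrow> ('k, 'd) ring_scheme \<Rightarrow> (ncpoly set \<Rightarrow> 'k) \<Rightarrow>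
    nat \<Rightarrow> complex \<Rightarrow> ncpoly set \<Rightarrow> ncpoly set" where
  "q_divdiff n q K \<iota> i \<epsilon> f =
    inv_into (carrier (q_sym n q)) \<iota>
      (inv\<^bsub>K\<^esub> (\<iota> (q_var n q i)) \<otimes>\<^bsub>K\<^esub> \<iota> (f \<ominus>\<^bsub>q_sym n q\<^esub> q_twist n q i \<epsilon> f))"

definition complex_units :: "complex monoid" where
  "complex_units = \<lparr>carrier = UNIV - {0}, monoid.mult = (*), one = 1\<rparr>"

definition braided_nabla ::
  "nat \<Rightarrow> (nat \<Rightarrow> nat \<Rightarrow> complex) \<Rightarrow> ('k, 'd) ring_scheme \<Rightarrow> (ncpoly set \<Rightarrow> 'k) \<Rightarrow>
    (nat \<Rightarrow> complex set) \<Rightarrow> (nat \<Rightarrow> complex \<Rightarrow> complex) \<Rightarrow> nat \<Rightarrow> ncpoly set \<Rightarrow> ncpoly set" where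
  "braided_nabla n q K \<iota> C c i f =
    braided_deriv n q i f \<oplus>\<^bsub>q_sym n q\<^esub>
      (\<Oplus>\<^bsub>q_sym n q\<^esub> \<epsilon> \<in> C i - {1}.
         q_scale n q (c i \<epsilon> / (1 - \<epsilon>)) (q_divdiff n q K \<iota> i \<epsilon> f))"

end

theory Submission
  imports Defs
begin

text \<open>Every ingredient of \<open>\<nabla>\<^sub>i\<close> lifts to the free algebra, and there the relations hold on the nose.
  The lift \<open>J\<^sub>\<epsilon>\<close> of \<open>(1 - \<epsilon>)\<^sup>-\<^sup>1 x\<^sub>i\<^sup>-\<^sup>1 (1 - t\<^sub>i)\<close> is determined by \<open>J\<^sub>\<epsilon> 1 = 0\<close> and
  \<open>J\<^sub>\<epsilon> (x\<^sub>k f) = q\<^sub>k\<^sub>i x\<^sub>k J\<^sub>\<epsilon> f + \<delta>\<^sub>i\<^sub>k t\<^sub>i f\<close>; for \<open>\<epsilon> = 1\<close> this recursion gives the braided partial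
  derivative. Both relations then follow by induction on words. A twisted Leibniz rule shows that
  \<open>J\<^sub>\<epsilon>\<close> preserves the defining ideal, so it descends to the quotient. No PBW basis is needed: ordered
  monomials only have to span, and \<open>x\<^sub>i \<noteq> 0\<close> in the quotient because \<open>J\<^sub>1 x\<^sub>i = 1\<close>.\<close>

section \<open>Linear operators on the free algebra\<close>

lemma Word_letters [simp]: "Word (letters w) = w"
  by (cases w) simp

lemma ncpoly_expansion:
  fixes p :: ncpoly
  shows "p = (\<Sum>w\<in>Poly_Mapping.keys p. Poly_Mapping.single w (Poly_Mapping.lookup p w))"
proof (rule poly_mapping_eqI)
  fix v
  have "Poly_Mapping.lookup (\<Sum>w\<in>Poly_Mapping.keys p.
      Poly_Mapping.single w (Poly_Mapping.lookup p w)) v =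
    (\<Sum>w\<in>Poly_Mapping.keys p. if w = v then Poly_Mapping.lookup p w else 0)"
    by (simp add: lookup_sum lookup_single when_def)
  also have "\<dots> = Poly_Mapping.lookup p v"
    by (simp add: in_keys_iff)
  finally show "Poly_Mapping.lookup p v = Poly_Mapping.lookup (\<Sum>w\<in>Poly_Mapping.keys p.
      Poly_Mapping.single w (Poly_Mapping.lookup p w)) v" ..
qed

lemma fconst_mult_single: "fconst z * Poly_Mapping.single w a = Poly_Mapping.single w (z * a)"
  by (simp add: fconst_def mult_single)

lemma fvar_mult_single:
  "fvar k * Poly_Mapping.single (Word ks) a = Poly_Mapping.single (Word (k # ks)) a"
  by (simp add: fvar_def mult_single plus_word_def)

lemma lookup_fconst_mult [simp]:
  "Poly_Mapping.lookup (fconst z * p) w = z * Poly_Mapping.lookup p w"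
proof -
  have "Poly_Mapping.lookup (fconst z * p) w = (\<Sum>v\<in>Poly_Mapping.keys p.
      Poly_Mapping.lookup (Poly_Mapping.single v (z * Poly_Mapping.lookup p v)) w)"
    by (subst ncpoly_expansion[of p])
      (simp only: sum_distrib_left fconst_mult_single lookup_sum)
  also have "\<dots> = z * Poly_Mapping.lookup p w"
    by (simp add: lookup_single when_def in_keys_iff)
  finally show ?thesis .
qed

lemma fconst_add: "fconst (a + b) = fconst a + fconst b"
  by (simp add: fconst_def single_add)

lemma fconst_mult: "fconst (a * b) = fconst a * fconst b"
  by (simp add: fconst_def mult_single)

lemma fconst_0 [simp]: "fconst 0 = 0" and fconst_1 [simp]: "fconst 1 = 1"
  by (simp_all add: fconst_def)

lemma fconst_uminus: "fconst (- a) = - fconst a"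
  by (simp add: fconst_def single_uminus)

lemma fconst_diff: "fconst (a - b) = fconst a - fconst b"
  by (simp add: fconst_def single_diff)

lemma fconst_mult_fconst: "fconst a * (fconst b * p) = fconst (a * b) * p"
  by (simp add: fconst_mult mult.assoc)

section \<open>Induction principles for noncommutative polynomials\<close>

lemma ncpoly_word_induct [consumes 1, case_names add scale word]:
  assumes "\<forall>w \<in> Poly_Mapping.keys p. set (letters w) \<subseteq> A"
    and add: "\<And>p r. P p \<Longrightarrow> P r \<Longrightarrow> P (p + r)"
    and scale: "\<And>z p. P p \<Longrightarrow> P (fconst z * p)"
    and word: "\<And>ks. set ks \<subseteq> A \<Longrightarrow> P (Poly_Mapping.single (Word ks) 1)"
  shows "P p"
proof -
  \<comment> \<open>The empty sum needs no hypothesis of its own: 0 is the empty word scaled by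
    0.\<close>
  have zero: "P 0" using scale[OF word[of "[]"], of 0] by simp
  have "P (\<Sum>w\<in>W. Poly_Mapping.single w (Poly_Mapping.lookup p w))"
    if "finite W" "W \<subseteq> Poly_Mapping.keys p" for W
    using that
  proof (induction W)
    case empty
    then show ?case using zero by simp
  next
    case (insert w W)
    have "P (fconst (Poly_Mapping.lookup p w) * Poly_Mapping.single (Word (letters w)) 1)"
      using assms(1) insert.prems by (intro scale word) auto
    then have "P (Poly_Mapping.single w (Poly_Mapping.lookup p w))"
      by (simp add: fconst_mult_single)
    then show ?case using insert add by simp
  qed
  then show ?thesis by (subst ncpoly_expansion) simp
qed

lemma single_Nil: "Poly_Mapping.single (Word []) 1 = (1 :: ncpoly)"
  by (simp flip: zero_word_def)

text \<open>Words grow by one letter on the left, the same shape as the recursions that characterise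
  the operators below, so identities between operators can be checked one letter at a time.\<close>

lemma ncpoly_induct [consumes 1, case_names add scale one var]:
  assumes "\<forall>w \<in> Poly_Mapping.keys p. set (letters w) \<subseteq> A"
    and add: "\<And>p r. P p \<Longrightarrow> P r \<Longrightarrow> P (p + r)"
    and scale: "\<And>z p. P p \<Longrightarrow> P (fconst z * p)"
    and one: "P 1"
    and var: "\<And>k p. k \<in> A \<Longrightarrow> P p \<Longrightarrow> P (fvar k * p)"
  shows "P p"
  using assms(1)
proof (induction p rule: ncpoly_word_induct)
  case (word ks)
  then show ?case
  proof (induction ks)
    case Nil
    then show ?case using one by (simp only: single_Nil)
  next
    case (Cons k ks)
    then show ?case using var[of k "Poly_Mapping.single (Word ks) 1"]
      by (simp add: fvar_mult_single)
  qed
qed (use add scale in blast)+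

lemma ncpoly_induct_all [case_names add scale one var]:
  assumes "\<And>p r. P p \<Longrightarrow> P r \<Longrightarrow> P (p + r)"
    and "\<And>z p. P p \<Longrightarrow> P (fconst z * p)"
    and "P 1"
    and "\<And>k p. P p \<Longrightarrow> P (fvar k * p)"
  shows "P p"
  by (rule ncpoly_induct[where A = UNIV and p = p]) (use assms in auto)

text \<open>Membership in the carrier is carried through the induction, so that closure conditions
  are available in every case.\<close>

lemma free_algebra_induct [consumes 1, case_names add scale one var]:
  assumes "p \<in> carrier (free_algebra n)"
    and "\<And>p r. p \<in> carrier (free_algebra n) \<Longrightarrow> P p \<Longrightarrow> r \<in> carrier (free_algebra n) \<Longrightarrow> P r \<Longrightarrow> P (p + r)"
    and "\<And>z p. p \<in> carrier (free_algebra n) \<Longrightarrow> P p \<Longrightarrow> P (fconst z * p)"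
    and "P 1"
    and "\<And>k p. k \<in> {1..n} \<Longrightarrow> p \<in> carrier (free_algebra n) \<Longrightarrow> P p \<Longrightarrow> P (fvar k * p)"
  shows "P p"
proof -
  have "p \<in> carrier (free_algebra n) \<and> P p"
    by (rule ncpoly_induct[OF assms(1)[unfolded in_free_algebra_iff]])
      (use assms(2-) in \<open>auto intro: free_algebra_add free_algebra_mult free_algebra_generators
        simp del: atLeastAtMost_iff One_nat_def\<close>)
  then show ?thesis by simp
qed

lemma fconst_commute: "p * fconst z = fconst z * p"
proof (induction p rule: ncpoly_induct_all)
  case (scale a p)
  then show ?case
    by (simp add: mult.assoc fconst_mult_fconst flip: fconst_mult)
      (simp add: mult.commute fconst_mult mult.assoc)
next
  case (var k p)
  have "fvar k * fconst z = fconst z * fvar k"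
    by (simp add: fvar_def fconst_def mult_single)
  then show ?case
    using var by (metis mult.assoc)
qed (simp_all add: algebra_simps)

text \<open>The guard keeps the simplifier from exchanging two scalars forever. All scalars collect
  at the front, where \<open>fconst_mult_fconst\<close> merges them.\<close>

lemma fconst_left_commute: "NO_MATCH (fconst w) p \<Longrightarrow> p * (fconst z * r) = fconst z * (p * r)"
  by (simp add: fconst_commute flip: mult.assoc)

lemmas fconst_normalize =
  mult.assoc fconst_mult_fconst fconst_left_commute fconst_mult[symmetric]

section \<open>Linear extension from words\<close>

definition lin_ext :: "(word \<Rightarrow> ncpoly) \<Rightarrow> ncpoly \<Rightarrow> ncpoly" where
  "lin_ext F p = (\<Sum>w\<in>Poly_Mapping.keys p. fconst (Poly_Mapping.lookup p w) * F w)"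

text \<open>Polynomials with different supports can thus be summed over one common index set, which
  is what additivity requires.\<close>

lemma lin_ext_superset:
  assumes "finite W" "Poly_Mapping.keys p \<subseteq> W"
  shows "lin_ext F p = (\<Sum>w\<in>W. fconst (Poly_Mapping.lookup p w) * F w)"
  unfolding lin_ext_def using assms by (intro sum.mono_neutral_left) (auto simp: in_keys_iff)

lemma lin_ext_add: "lin_ext F (p + r) = lin_ext F p + lin_ext F r"
proof -
  let ?W = "Poly_Mapping.keys p \<union> Poly_Mapping.keys r"
  show ?thesis
    using Poly_Mapping.keys_add[of p r]
    by (simp add: lin_ext_superset[of ?W] lookup_add fconst_add algebra_simps sum.distrib)
qed

lemma lin_ext_scale: "lin_ext F (fconst z * p) = fconst z * lin_ext F p"
proof -
  have "Poly_Mapping.keys (fconst z * p) \<subseteq> Poly_Mapping.keys p"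
    by (auto simp: in_keys_iff)
  then show ?thesis
    by (simp add: lin_ext_superset[of "Poly_Mapping.keys p"] sum_distrib_left fconst_normalize)
qed

lemma lin_ext_single: "lin_ext F (Poly_Mapping.single w 1) = F w"
  by (simp add: lin_ext_def)

lemma lin_ext_one: "lin_ext F 1 = F (Word [])"
  using lin_ext_single[of F "Word []"] by (simp only: single_Nil)

locale ncpoly_linear =
  fixes L :: "ncpoly \<Rightarrow> ncpoly"
  assumes add: "L (p + r) = L p + L r"
    and scale: "L (fconst z * p) = fconst z * L p"
begin

lemma zero: "L 0 = 0"
  using scale[of 0 0] by simp

lemma uminus: "L (- p) = - L p"
  using scale[of "-1" p] by (simp add: fconst_uminus)

lemma diff: "L (p - r) = L p - L r"
  using add[of p "- r"] uminus by simp

end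

lemma ncpoly_linear_lin_ext: "ncpoly_linear (lin_ext F)"
  by unfold_locales (rule lin_ext_add lin_ext_scale)+

lemma ncpoly_linear_eqI:
  assumes "ncpoly_linear L" "ncpoly_linear M"
    and "\<And>ks. L (Poly_Mapping.single (Word ks) 1) = M (Poly_Mapping.single (Word ks) 1)"
  shows "L p = M p"
  by (rule ncpoly_word_induct[where A = UNIV and p = p])
    (use assms in \<open>simp_all add: ncpoly_linear.add ncpoly_linear.scale\<close>)

section \<open>Diagonal automorphisms and Jackson derivatives\<close>

text \<open>The algebra endomorphism that multiplies each x_k by \<open>\<chi> k\<close>. It serves
  as the twist t_i and, with \<open>\<chi> k = q k i\<close>, as the braiding factor in the Leibniz
  rule.\<close>

definition scale_vars :: "(nat \<Rightarrow> complex) \<Rightarrow> ncpoly \<Rightarrow> ncpoly" where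
  "scale_vars \<chi> =
    lin_ext (\<lambda>w. fconst (prod_list (map \<chi> (letters w))) * Poly_Mapping.single w 1)"

interpretation scale_vars: ncpoly_linear "scale_vars \<chi>" for \<chi>
  unfolding scale_vars_def by (rule ncpoly_linear_lin_ext)

lemma scale_vars_one: "scale_vars \<chi> 1 = 1"
  by (simp add: scale_vars_def lin_ext_one single_Nil)

text \<open>Both sides are linear in \<open>p\<close>, so it suffices to compare them on words.
  Together with \<open>scale_vars_one\<close>, this recursion replaces the definition in later
  proofs.\<close>

lemma scale_vars_var:
  "scale_vars \<chi> (fvar k * p) = fconst (\<chi> k) * (fvar k * scale_vars \<chi> p)" (is "?L p = ?M p")
proof (rule ncpoly_linear_eqI[where L = ?L and M = ?M])
  show "ncpoly_linear ?L"
    by unfold_locales (simp_all add: fconst_left_commute distrib_left scale_vars.add scale_vars.scale)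
  show "ncpoly_linear ?M"
    by unfold_locales (simp_all add: fconst_normalize distrib_left scale_vars.add scale_vars.scale mult.commute)
qed (simp add: fvar_mult_single scale_vars_def lin_ext_single fconst_mult_single)

lemma scale_vars_const: "scale_vars \<chi> (fconst z) = fconst z"
  using scale_vars.scale[of \<chi> z 1] by (simp add: scale_vars_one)

lemma scale_vars_fvar: "scale_vars \<chi> (fvar k) = fconst (\<chi> k) * fvar k"
  using scale_vars_var[of \<chi> k 1] by (simp add: scale_vars_one)

lemma scale_vars_mult: "scale_vars \<chi> (p * r) = scale_vars \<chi> p * scale_vars \<chi> r"
  by (induction p rule: ncpoly_induct_all)
    (simp_all add: scale_vars.add scale_vars.scale scale_vars_one scale_vars_var
      distrib_right mult.assoc)

lemma scale_vars_scale_vars: "scale_vars \<chi> (scale_vars \<psi> p) = scale_vars (\<lambda>k. \<chi> k * \<psi> k) p"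
  by (induction p rule: ncpoly_induct_all)
    (simp_all add: scale_vars.add scale_vars.scale scale_vars_one scale_vars_var
      fconst_normalize mult.commute)

lemma scale_vars_id: "scale_vars (\<lambda>k. 1) p = p"
  by (induction p rule: ncpoly_induct_all)
    (simp_all add: scale_vars.add scale_vars.scale scale_vars_one scale_vars_var)

lemma scale_vars_closed:
  "p \<in> carrier (free_algebra n) \<Longrightarrow> scale_vars \<chi> p \<in> carrier (free_algebra n)"
  by (induction p rule: free_algebra_induct)
    (simp_all add: scale_vars.add scale_vars.scale scale_vars_one scale_vars_var
      free_algebra_add free_algebra_mult free_algebra_generators del: atLeastAtMost_iff One_nat_def)

abbreviation twist :: "nat \<Rightarrow> complex \<Rightarrow> ncpoly \<Rightarrow> ncpoly" where
  "twist i \<epsilon> \<equiv> scale_vars (\<lambda>k. if k = i then \<epsilon> else 1)"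

text \<open>For \<open>\<chi> i = 1\<close> the word x_i^m goes to (1 + \<epsilon> + ... +
  \<epsilon>^(m-1)) x_i^(m-1), which is the classical Jackson derivative, and the ordinary
  derivative when \<open>\<epsilon> = 1\<close>. Passing a letter x_k costs the factor
  \<open>\<chi> k\<close>; the choice \<open>\<chi> k = q k i\<close> is made later.\<close>

fun jackson_word :: "(nat \<Rightarrow> complex) \<Rightarrow> nat \<Rightarrow> complex \<Rightarrow> nat list \<Rightarrow> ncpoly" where
  "jackson_word \<chi> i \<epsilon> [] = 0"
| "jackson_word \<chi> i \<epsilon> (k # ks) = fconst (\<chi> k) * (fvar k * jackson_word \<chi> i \<epsilon> ks) +
    (if k = i then twist i \<epsilon> (Poly_Mapping.single (Word ks) 1) else 0)"

definition jackson :: "(nat \<Rightarrow> complex) \<Rightarrow> nat \<Rightarrow> complex \<Rightarrow> ncpoly \<Rightarrow> ncpoly" where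
  "jackson \<chi> i \<epsilon> = lin_ext (\<lambda>w. jackson_word \<chi> i \<epsilon> (letters w))"

interpretation jackson: ncpoly_linear "jackson \<chi> i \<epsilon>" for \<chi> i \<epsilon>
  unfolding jackson_def by (rule ncpoly_linear_lin_ext)

lemma jackson_one: "jackson \<chi> i \<epsilon> 1 = 0"
  by (simp add: jackson_def lin_ext_one)

lemma jackson_var:
  "jackson \<chi> i \<epsilon> (fvar k * p) =
    fconst (\<chi> k) * (fvar k * jackson \<chi> i \<epsilon> p) + (if k = i then twist i \<epsilon> p else 0)" (is "?L p = ?M p")
proof (rule ncpoly_linear_eqI[where L = ?L and M = ?M])
  show "ncpoly_linear ?L"
    by unfold_locales (simp_all add: fconst_left_commute distrib_left jackson.add jackson.scale)
  show "ncpoly_linear ?M"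
    by unfold_locales
      (simp_all add: fconst_normalize distrib_left scale_vars.add scale_vars.scale
        jackson.add jackson.scale mult.commute)
qed (simp add: fvar_mult_single jackson_def lin_ext_single)

lemma jackson_fvar: "jackson \<chi> i \<epsilon> (fvar k) = (if k = i then 1 else 0)"
  using jackson_var[of \<chi> i \<epsilon> k 1] by (simp add: jackson_one scale_vars_one)

lemma jackson_closed:
  "p \<in> carrier (free_algebra n) \<Longrightarrow> jackson \<chi> i \<epsilon> p \<in> carrier (free_algebra n)"
  by (induction p rule: free_algebra_induct)
    (simp_all add: jackson.add jackson.scale jackson_one jackson_var scale_vars_closed
      free_algebra_add free_algebra_mult free_algebra_generators del: atLeastAtMost_iff One_nat_def)

text \<open>The operator is a skew derivation: the right factor is twisted by t_i, the left one by
  the diagonal map of \<open>\<chi>\<close>. In the induction on the left factor, the extra term at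
  a letter x_i splits because the twist is multiplicative.\<close>

lemma jackson_mult:
  "jackson \<chi> i \<epsilon> (p * r) = jackson \<chi> i \<epsilon> p * twist i \<epsilon> r + scale_vars \<chi> p * jackson \<chi> i \<epsilon> r"
  by (induction p rule: ncpoly_induct_all)
    (simp_all add: jackson.add jackson.scale jackson_one jackson_var scale_vars.add
      scale_vars.scale scale_vars_one scale_vars_var scale_vars_mult
      scale_vars_fvar scale_vars_const distrib_right distrib_left mult.assoc)

text \<open>The twist leaves the letter x_j alone, and diagonal maps commute, so the recursions of
  both sides agree. For \<open>i = j\<close> the removed letter would have left behind a factor
  \<epsilon>.\<close>

lemma twist_jackson:
  assumes "i \<noteq> j"
  shows "twist i \<epsilon> (jackson \<chi> j \<eta> p) = jackson \<chi> j \<eta> (twist i \<epsilon> p)"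
proof (induction p rule: ncpoly_induct_all)
  case (var k p)
  then show ?case using assms
    by (simp add: jackson.add jackson.scale jackson_var scale_vars.add scale_vars.scale
        scale_vars_var scale_vars.zero fconst_normalize distrib_left scale_vars_scale_vars mult.commute)
qed (simp_all add: jackson.add jackson.scale jackson_one scale_vars.add scale_vars.scale
    scale_vars_one scale_vars.zero jackson.zero)

text \<open>Induction on words. A letter other than x_i and x_j gives the same factor on both sides.
  For x_i the extra terms match by \<open>twist_jackson\<close>; for x_j they match because, in
  addition, \<open>q i j * q j i = 1\<close>. The two parameters \<epsilon> and \<eta> are
  independent, so sums over them will commute in the same way.\<close>

lemma jackson_jackson:
  assumes "q i j * q j i = 1" "i \<noteq> j"
  shows "jackson (\<lambda>k. q k i) i \<epsilon> (jackson (\<lambda>k. q k j) j \<eta> p) =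
    fconst (q i j) * jackson (\<lambda>k. q k j) j \<eta> (jackson (\<lambda>k. q k i) i \<epsilon> p)"
proof (induction p rule: ncpoly_induct_all)
  case (var k p)
  then show ?case using assms
    by (auto simp: jackson.add jackson.scale jackson_var scale_vars.add scale_vars.scale
        twist_jackson jackson.zero fconst_normalize distrib_left mult_ac)
qed (simp_all add: jackson.add jackson.scale jackson_one jackson.zero distrib_left fconst_normalize
  mult.commute)

section \<open>Descent to the quantum symmetric algebra\<close>

lemma q_relators_closed: "q_relators n q \<subseteq> carrier (free_algebra n)"
  unfolding q_relators_def
  by (clarify, intro free_algebra_diff free_algebra_mult free_algebra_generators)

lemma q_relators_subset_ideal: "q_relators n q \<subseteq> q_ideal n q"
  unfolding q_ideal_def by (rule ring.genideal_self[OF ring_free_algebra q_relators_closed])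

lemma q_ideal_minimal:
  "ideal J (free_algebra n) \<Longrightarrow> q_relators n q \<subseteq> J \<Longrightarrow> q_ideal n q \<subseteq> J"
  unfolding q_ideal_def by (rule ring.genideal_minimal[OF ring_free_algebra])

text \<open>Closure under negation comes from closure under left multiplication, since
  \<open>- p\<close> is \<open>fconst (- 1) * p\<close>.\<close>

lemma ideal_free_algebraI:
  assumes "J \<subseteq> carrier (free_algebra n)" "0 \<in> J"
    and "\<And>p r. p \<in> J \<Longrightarrow> r \<in> J \<Longrightarrow> p + r \<in> J"
    and "\<And>p u. p \<in> J \<Longrightarrow> u \<in> carrier (free_algebra n) \<Longrightarrow> u * p \<in> J"
    and "\<And>p u. p \<in> J \<Longrightarrow> u \<in> carrier (free_algebra n) \<Longrightarrow> p * u \<in> J"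
  shows "ideal J (free_algebra n)"
proof (rule idealI[OF ring_free_algebra])
  interpret ring "free_algebra n" by (rule ring_free_algebra)
  have minus: "\<ominus>\<^bsub>free_algebra n\<^esub> p = fconst (- 1) * p" if "p \<in> carrier (free_algebra n)" for p
    using that by (intro minus_equality)
      (simp_all add: fconst_uminus free_algebra_uminus)
  show "subgroup J (add_monoid (free_algebra n))"
  proof (rule group.subgroupI)
    show "group (add_monoid (free_algebra n))" by (rule add.is_group)
    show "inv\<^bsub>add_monoid (free_algebra n)\<^esub> p \<in> J" if "p \<in> J" for p
      using minus[of p] that assms(1,4) free_algebra_generators(3) unfolding a_inv_def by auto
  qed (use assms in auto)
qed (use assms in auto)

lemma q_ideal_closed: "p \<in> q_ideal n q \<Longrightarrow> p \<in> carrier (free_algebra n)"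
  using ideal.Icarr[OF ideal_q_ideal] .

lemma q_ideal_zero: "0 \<in> q_ideal n q"
  using additive_subgroup.zero_closed[OF ideal.axioms(1)[OF ideal_q_ideal]] by simp

lemma q_ideal_add: "p \<in> q_ideal n q \<Longrightarrow> r \<in> q_ideal n q \<Longrightarrow> p + r \<in> q_ideal n q"
  using additive_subgroup.a_closed[OF ideal.axioms(1)[OF ideal_q_ideal], of p n q r] by simp

lemma q_ideal_lmult:
  "p \<in> q_ideal n q \<Longrightarrow> u \<in> carrier (free_algebra n) \<Longrightarrow> u * p \<in> q_ideal n q"
  using ideal.I_l_closed[OF ideal_q_ideal, of p n q u] by simp

lemma q_ideal_rmult:
  "p \<in> q_ideal n q \<Longrightarrow> u \<in> carrier (free_algebra n) \<Longrightarrow> p * u \<in> q_ideal n q"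
  using ideal.I_r_closed[OF ideal_q_ideal, of p n q u] by simp

section \<open>The quotient map\<close>

definition q_proj :: "nat \<Rightarrow> (nat \<Rightarrow> nat \<Rightarrow> complex) \<Rightarrow> ncpoly \<Rightarrow> ncpoly set" where
  "q_proj n q p = q_ideal n q +>\<^bsub>free_algebra n\<^esub> p"

lemma q_proj_hom: "q_proj n q \<in> ring_hom (free_algebra n) (q_sym n q)"
  using ideal.rcos_ring_hom[OF ideal_q_ideal] unfolding q_sym_def q_proj_def[abs_def] .

lemma q_var_eq_proj: "q_var n q i = q_proj n q (fvar i)"
  by (simp add: q_var_def q_proj_def)

lemma carrier_q_sym: "carrier (q_sym n q) = q_proj n q ` carrier (free_algebra n)"
  by (auto simp: q_sym_def FactRing_def A_RCOSETS_def' q_proj_def)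

lemma q_proj_closed: "p \<in> carrier (free_algebra n) \<Longrightarrow> q_proj n q p \<in> carrier (q_sym n q)"
  by (simp add: carrier_q_sym)

lemma q_proj_add:
  "p \<in> carrier (free_algebra n) \<Longrightarrow> r \<in> carrier (free_algebra n) \<Longrightarrow>
    q_proj n q (p + r) = q_proj n q p \<oplus>\<^bsub>q_sym n q\<^esub> q_proj n q r"
  using ring_hom_add[OF q_proj_hom, of p n r q] by simp

lemma q_proj_mult:
  "p \<in> carrier (free_algebra n) \<Longrightarrow> r \<in> carrier (free_algebra n) \<Longrightarrow>
    q_proj n q (p * r) = q_proj n q p \<otimes>\<^bsub>q_sym n q\<^esub> q_proj n q r"
  using ring_hom_mult[OF q_proj_hom, of p n r q] by simp

lemma q_proj_one: "q_proj n q 1 = \<one>\<^bsub>q_sym n q\<^esub>"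
  using ring_hom_one[OF q_proj_hom, of n q] by simp

lemma q_proj_zero: "q_proj n q 0 = \<zero>\<^bsub>q_sym n q\<^esub>"
  using ring_hom_zero[OF q_proj_hom ring_free_algebra ring_q_sym, of n q] by simp

lemma q_proj_uminus:
  assumes "p \<in> carrier (free_algebra n)"
  shows "q_proj n q (- p) = \<ominus>\<^bsub>q_sym n q\<^esub> q_proj n q p"
proof -
  interpret ring "q_sym n q" by (rule ring_q_sym)
  show ?thesis
    using assms q_proj_add[of "- p" n p q]
    by (intro minus_equality[symmetric])
      (simp_all add: q_proj_zero q_proj_closed free_algebra_uminus)
qed

lemma q_proj_diff:
  "p \<in> carrier (free_algebra n) \<Longrightarrow> r \<in> carrier (free_algebra n) \<Longrightarrow>
    q_proj n q (p - r) = q_proj n q p \<ominus>\<^bsub>q_sym n q\<^esub> q_proj n q r"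
  using q_proj_add[of p n "- r" q] by (simp add: q_proj_uminus free_algebra_uminus a_minus_def)

lemma q_proj_eq_zero_iff:
  assumes "p \<in> carrier (free_algebra n)"
  shows "q_proj n q p = \<zero>\<^bsub>q_sym n q\<^esub> \<longleftrightarrow> p \<in> q_ideal n q"
proof -
  interpret ideal "q_ideal n q" "free_algebra n" by (rule ideal_q_ideal)
  have "\<zero>\<^bsub>q_sym n q\<^esub> = q_ideal n q" by (simp add: q_sym_def FactRing_def)
  then show ?thesis
    using a_rcos_const[of p] a_rcos_self[of p] assms by (auto simp: q_proj_def)
qed

lemma q_proj_eq_iff:
  assumes "p \<in> carrier (free_algebra n)" "r \<in> carrier (free_algebra n)"
  shows "q_proj n q p = q_proj n q r \<longleftrightarrow> p - r \<in> q_ideal n q"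
proof -
  interpret ring "q_sym n q" by (rule ring_q_sym)
  have "q_proj n q p = q_proj n q r \<longleftrightarrow> q_proj n q (p - r) = \<zero>\<^bsub>q_sym n q\<^esub>"
    using assms by (simp add: q_proj_diff)
      (metis q_proj_closed a_inv_closed minus_eq minus_equality minus_minus r_neg)
  then show ?thesis using assms by (simp add: q_proj_eq_zero_iff free_algebra_diff)
qed

lemma q_proj_scale:
  "p \<in> carrier (free_algebra n) \<Longrightarrow> q_scale n q z (q_proj n q p) = q_proj n q (fconst z * p)"
  by (simp add: q_scale_def q_proj_mult free_algebra_generators flip: q_proj_def)

text \<open>Closure of the sum is proved alongside, because the induction step must apply
  \<open>q_proj_add\<close> to the remaining sum.\<close>

lemma q_proj_sum:
  assumes "finite E" "\<And>e. e \<in> E \<Longrightarrow> g e \<in> carrier (free_algebra n)"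
  shows "q_proj n q (\<Sum>e\<in>E. g e) = (\<Oplus>\<^bsub>q_sym n q\<^esub> e \<in> E. q_proj n q (g e)) \<and>
    (\<Sum>e\<in>E. g e) \<in> carrier (free_algebra n)"
  using assms
proof (induction E)
  case empty
  interpret ring "q_sym n q" by (rule ring_q_sym)
  show ?case by (simp add: q_proj_zero free_algebra_generators)
next
  case (insert e E)
  interpret ring "q_sym n q" by (rule ring_q_sym)
  show ?case using insert
    by (simp add: finsum_insert q_proj_add q_proj_closed free_algebra_add)
qed

section \<open>Descent of linear operators to the quotient\<close>

definition descends ::
  "nat \<Rightarrow> (nat \<Rightarrow> nat \<Rightarrow> complex) \<Rightarrow> (ncpoly \<Rightarrow> ncpoly) \<Rightarrow> bool" where
  "descends n q L \<longleftrightarrow> ncpoly_linear L \<and>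
    (\<forall>p \<in> carrier (free_algebra n). L p \<in> carrier (free_algebra n)) \<and>
    (\<forall>p \<in> q_ideal n q. L p \<in> q_ideal n q)"

text \<open>A representative is chosen in each coset. Restriction to the carrier supplies the
  extensionality demanded by the definite descriptions of \<open>braided_deriv\<close> and
  \<open>q_twist\<close>.\<close>

definition descend ::
  "nat \<Rightarrow> (nat \<Rightarrow> nat \<Rightarrow> complex) \<Rightarrow> (ncpoly \<Rightarrow> ncpoly) \<Rightarrow> ncpoly set \<Rightarrow> ncpoly set" where
  "descend n q L = restrict
    (\<lambda>f. q_proj n q (L (SOME p. p \<in> carrier (free_algebra n) \<and> q_proj n q p = f)))
    (carrier (q_sym n q))"

lemma descend_extensional: "descend n q L \<in> extensional (carrier (q_sym n q))"
  by (simp add: descend_def)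

text \<open>Two representatives differ by an element of the ideal, which \<open>L\<close> preserves,
  so the choice does not matter.\<close>

lemma descend_proj:
  assumes L: "descends n q L" and p: "p \<in> carrier (free_algebra n)"
  shows "descend n q L (q_proj n q p) = q_proj n q (L p)"
proof -
  interpret ncpoly_linear L using L by (simp add: descends_def)
  define r where "r = (SOME r. r \<in> carrier (free_algebra n) \<and> q_proj n q r = q_proj n q p)"
  have r: "r \<in> carrier (free_algebra n)" "q_proj n q r = q_proj n q p"
    using someI[of "\<lambda>r. r \<in> carrier (free_algebra n) \<and> q_proj n q r = q_proj n q p" p] p
    by (simp_all add: r_def)
  then have "L (r - p) \<in> q_ideal n q"
    using L p by (simp add: q_proj_eq_iff descends_def)
  then have "q_proj n q (L r) = q_proj n q (L p)"
    using L p r by (simp add: q_proj_eq_iff descends_def diff)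
  then show ?thesis
    using p by (simp add: descend_def q_proj_closed flip: r_def)
qed

lemma q_linear_descend:
  assumes "descends n q L"
  shows "q_linear n q (descend n q L)"
proof -
  interpret ncpoly_linear L using assms by (simp add: descends_def)
  have "L p \<in> carrier (free_algebra n)" if "p \<in> carrier (free_algebra n)" for p
    using assms that by (simp add: descends_def)
  then show ?thesis
    unfolding q_linear_def
    by (auto simp: carrier_q_sym q_proj_scale descend_proj[OF assms] add scale free_algebra_mult
        free_algebra_add free_algebra_generators simp flip: q_proj_add)
qed

lemma q_sym_induct [consumes 1, case_names add scale one var]:
  assumes "f \<in> carrier (q_sym n q)"
    and "\<And>f g. f \<in> carrier (q_sym n q) \<Longrightarrow> P f \<Longrightarrow> g \<in> carrier (q_sym n q) \<Longrightarrow> P g \<Longrightarrow>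
      P (f \<oplus>\<^bsub>q_sym n q\<^esub> g)"
    and "\<And>z f. f \<in> carrier (q_sym n q) \<Longrightarrow> P f \<Longrightarrow> P (q_scale n q z f)"
    and "P \<one>\<^bsub>q_sym n q\<^esub>"
    and "\<And>k f. k \<in> {1..n} \<Longrightarrow> f \<in> carrier (q_sym n q) \<Longrightarrow> P f \<Longrightarrow>
      P (q_var n q k \<otimes>\<^bsub>q_sym n q\<^esub> f)"
  shows "P f"
proof -
  have "P (q_proj n q p)" if "p \<in> carrier (free_algebra n)" for p
    using that
  proof (induction p rule: free_algebra_induct)
    case (scale z p)
    then show ?case using assms(3)[of "q_proj n q p" z] by (simp add: q_proj_scale q_proj_closed)
  next
    case (var k p)
    then show ?case using assms(5)[of k "q_proj n q p"]
      by (simp add: q_proj_mult q_proj_closed q_var_eq_proj free_algebra_generators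
          del: atLeastAtMost_iff One_nat_def)
  qed (simp_all add: assms q_proj_add q_proj_closed q_proj_one)
  then show ?thesis using assms(1) by (auto simp: carrier_q_sym)
qed

text \<open>Both terms of a relator contain the same letters with the same multiplicities, so a
  diagonal map multiplies them by the same scalar.\<close>

lemma scale_vars_relator:
  assumes "r \<in> q_relators n q"
  shows "\<exists>z. scale_vars \<chi> r = fconst z * r"
proof -
  obtain i j where r: "r = fvar i * fvar j - fconst (q i j) * fvar j * fvar i"
    using assms by (auto simp: q_relators_def)
  have "scale_vars \<chi> r = fconst (\<chi> i * \<chi> j) * r"
    by (simp add: r scale_vars.diff scale_vars_mult scale_vars_fvar scale_vars_const
        fconst_normalize right_diff_distrib mult_ac)
  then show ?thesis ..
qed

lemma scale_vars_ideal:
  assumes "p \<in> q_ideal n q"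
  shows "scale_vars \<chi> p \<in> q_ideal n q"
proof -
  \<comment> \<open>The elements whose image stays in the ideal form an ideal themselves; minimality
    of \<open>q_ideal n q\<close> then reduces the claim to the relators.\<close>
  let ?J = "{p \<in> q_ideal n q. scale_vars \<chi> p \<in> q_ideal n q}"
  have "ideal ?J (free_algebra n)"
    by (rule ideal_free_algebraI)
      (auto simp: q_ideal_zero q_ideal_add q_ideal_lmult q_ideal_rmult scale_vars.add
        scale_vars.zero scale_vars_mult scale_vars_closed intro: q_ideal_closed)
  moreover have "q_relators n q \<subseteq> ?J"
  proof
    fix r assume r: "r \<in> q_relators n q"
    then have "r \<in> q_ideal n q" using q_relators_subset_ideal by auto
    moreover obtain z where "scale_vars \<chi> r = fconst z * r"
      using scale_vars_relator[OF r] by blast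
    ultimately show "r \<in> ?J"
      by (simp add: q_ideal_lmult free_algebra_generators)
  qed
  ultimately show ?thesis using q_ideal_minimal assms by blast
qed

lemma descends_scale_vars: "descends n q (scale_vars \<chi>)"
  by (simp add: descends_def scale_vars.ncpoly_linear_axioms scale_vars_closed scale_vars_ideal)

section \<open>Jackson derivatives on the quotient\<close>

locale quantum_parameters =
  fixes n :: nat and q :: "nat \<Rightarrow> nat \<Rightarrow> complex"
  assumes q_diag: "i \<in> {1..n} \<Longrightarrow> q i i = 1"
    and q_inv: "i \<in> {1..n} \<Longrightarrow> j \<in> {1..n} \<Longrightarrow> q i j * q j i = 1"
begin

abbreviation q_jackson :: "nat \<Rightarrow> complex \<Rightarrow> ncpoly \<Rightarrow> ncpoly" where
  "q_jackson i \<equiv> jackson (\<lambda>k. q k i) i"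

text \<open>This is what the weights \<open>q k i\<close> are made for. If only the left letter of
  the first product is x_i, the two terms cancel by \<open>q i l * q l i = 1\<close>; if only the
  right one is, both terms carry the factor \<open>q k i\<close>. If both letters are x_i, the
  relator itself vanishes since \<open>q i i = 1\<close>.\<close>

lemma jackson_relator:
  assumes "r \<in> q_relators n q" "i \<in> {1..n}"
  shows "q_jackson i \<epsilon> r = 0"
proof -
  obtain k l where r: "r = fvar k * fvar l - fconst (q k l) * (fvar l * fvar k)"
    and kl: "k \<in> {1..n}" "l \<in> {1..n}"
    using assms by (auto simp: q_relators_def mult.assoc)
  show ?thesis
    using q_diag[OF assms(2)] q_inv[OF assms(2) kl(1)] q_inv[OF assms(2) kl(2)]
    by (auto simp: r jackson.diff jackson.scale jackson_var jackson_fvar scale_vars_fvar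
        fconst_normalize distrib_left jackson.zero)
qed

lemma jackson_ideal:
  assumes "p \<in> q_ideal n q" "i \<in> {1..n}"
  shows "q_jackson i \<epsilon> p \<in> q_ideal n q"
proof -
  \<comment> \<open>Here the condition \<open>p \<in> q_ideal n q\<close> matters for closure under
    multiplication: the Leibniz rule produces a term in which \<open>p\<close> is not
    differentiated, only scaled by a diagonal map.\<close>
  let ?J = "{p \<in> q_ideal n q. q_jackson i \<epsilon> p \<in> q_ideal n q}"
  have "ideal ?J (free_algebra n)"
    by (rule ideal_free_algebraI)
      (auto simp: q_ideal_zero q_ideal_add q_ideal_lmult q_ideal_rmult jackson.add
        jackson.zero jackson_mult scale_vars_closed scale_vars_ideal jackson_closed
        intro: q_ideal_closed)
  moreover have "q_relators n q \<subseteq> ?J"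
    using q_relators_subset_ideal jackson_relator assms(2) by (auto simp: q_ideal_zero)
  ultimately show ?thesis using q_ideal_minimal assms by blast
qed

lemma descends_jackson: "i \<in> {1..n} \<Longrightarrow> descends n q (q_jackson i \<epsilon>)"
  by (simp add: descends_def jackson.ncpoly_linear_axioms jackson_closed jackson_ideal
      del: atLeastAtMost_iff One_nat_def)

end

section \<open>Ordered monomials\<close>

text \<open>A lift of \<open>q_monom\<close> with an arbitrary list of indices in place of
  \<open>[1..<Suc n]\<close>, so that induction on the list is possible.\<close>

definition free_monom :: "nat list \<Rightarrow> (nat \<Rightarrow> nat) \<Rightarrow> ncpoly" where
  "free_monom ks a = foldr (*) (map (\<lambda>k. fvar k ^ a k) ks) 1"

lemma free_monom_simps [simp]:
  "free_monom [] a = 1" "free_monom (k # ks) a = fvar k ^ a k * free_monom ks a"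
  by (simp_all add: free_monom_def)

lemma free_monom_cong:
  "(\<And>k. k \<in> set ks \<Longrightarrow> a k = b k) \<Longrightarrow> free_monom ks a = free_monom ks b"
  by (induction ks) simp_all

lemma fvar_power_closed: "k \<in> {1..n} \<Longrightarrow> fvar k ^ m \<in> carrier (free_algebra n)"
  by (induction m) (simp_all add: free_algebra_mult free_algebra_generators del: atLeastAtMost_iff One_nat_def)

lemma free_monom_closed: "set ks \<subseteq> {1..n} \<Longrightarrow> free_monom ks a \<in> carrier (free_algebra n)"
  by (induction ks)
    (simp_all add: free_algebra_mult free_algebra_generators fvar_power_closed
      del: atLeastAtMost_iff One_nat_def)

lemma q_proj_fvar_power:
  assumes "k \<in> {1..n}"
  shows "q_proj n q (fvar k ^ m) = q_var n q k [^]\<^bsub>q_sym n q\<^esub> m"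
proof (induction m)
  interpret ring "q_sym n q" by (rule ring_q_sym)
  case 0
  show ?case by (simp add: q_proj_one)
next
  interpret ring "q_sym n q" by (rule ring_q_sym)
  case (Suc m)
  then show ?case using assms
    by (simp add: power_Suc2 q_proj_mult fvar_power_closed free_algebra_generators q_var_eq_proj
        del: power_Suc atLeastAtMost_iff One_nat_def)
qed

lemma q_proj_free_monom:
  assumes "set ks \<subseteq> {1..n}"
  shows "q_proj n q (free_monom ks a) =
    foldr (\<otimes>\<^bsub>q_sym n q\<^esub>) (map (\<lambda>k. q_var n q k [^]\<^bsub>q_sym n q\<^esub> a k) ks) \<one>\<^bsub>q_sym n q\<^esub>"
  using assms
  by (induction ks)
    (simp_all add: q_proj_one q_proj_mult free_monom_closed fvar_power_closed q_proj_fvar_power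
      del: atLeastAtMost_iff One_nat_def)

lemma q_monom_eq_proj: "q_monom n q a = q_proj n q (free_monom [1..<Suc n] a)"
  unfolding q_monom_def by (subst q_proj_free_monom) auto

section \<open>Jackson derivatives of ordered monomials\<close>

lemma jackson_power_other:
  assumes "k \<noteq> i"
  shows "jackson \<chi> i \<epsilon> (fvar k ^ m * p) = fconst (\<chi> k ^ m) * (fvar k ^ m * jackson \<chi> i \<epsilon> p)"
  using assms by (induction m) (simp_all add: mult.assoc jackson_var fconst_normalize)

text \<open>At \<open>\<epsilon> = 1\<close> the twist is the identity and
  \<open>\<chi> i = 1\<close> removes the weight, which leaves the ordinary power rule. For
  \<open>m = 0\<close> the truncated exponent is multiplied by 0.\<close>

lemma jackson_power_same:
  assumes "\<chi> i = 1"
  shows "jackson \<chi> i 1 (fvar i ^ m * p) =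
    fconst (of_nat m) * (fvar i ^ (m - 1) * p) + fvar i ^ m * jackson \<chi> i 1 p"
proof (induction m)
  case (Suc m)
  then show ?case using assms
    by (cases m) (simp_all add: jackson_var mult.assoc scale_vars_id fconst_normalize
      fconst_add fconst_add[of 1 1, simplified] mult_2 distrib_left distrib_right)
qed simp

lemma jackson_monom_notin:
  "i \<notin> set ks \<Longrightarrow> jackson \<chi> i \<epsilon> (free_monom ks a) = 0"
  by (induction ks) (simp_all add: jackson_one jackson_power_other)

text \<open>The operator passes the powers to the left of x_i, collecting their weights, then
  differentiates the power of x_i; the letters after it contribute nothing by
  \<open>jackson_monom_notin\<close>. Sortedness identifies the letters to the left with those below
  \<open>i\<close>.\<close>

lemma jackson_monom:
  assumes "\<chi> i = 1"
  shows "i \<in> set ks \<Longrightarrow> sorted_wrt (<) ks \<Longrightarrow>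
    jackson \<chi> i 1 (free_monom ks a) =
      fconst (of_nat (a i) * (\<Prod>k | k \<in> set ks \<and> k < i. \<chi> k ^ a k)) *
        free_monom ks (a(i := a i - 1))"
proof (induction ks)
  case (Cons l ks)
  show ?case
  proof (cases "l = i")
    case True
    then have notin: "i \<notin> set ks" using Cons.prems by auto
    have "(\<Prod>k | k \<in> set (l # ks) \<and> k < i. \<chi> k ^ a k) = 1"
      using Cons.prems True by (intro prod.neutral) auto
    moreover have "free_monom ks (a(i := a i - 1)) = free_monom ks a"
      using Cons.prems True by (intro free_monom_cong) auto
    moreover have "jackson \<chi> i 1 (free_monom (l # ks) a) =
        fconst (of_nat (a i)) * (fvar i ^ (a i - 1) * free_monom ks a)"
      using True jackson_power_same[where \<chi> = \<chi>, OF assms]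
        jackson_monom_notin[OF notin, of \<chi> 1 a] by simp
    ultimately show ?thesis
      using True by (simp del: fun_upd_apply add: fun_upd_same)
  next
    case False
    have "{k. k \<in> set (l # ks) \<and> k < i} = insert l {k. k \<in> set ks \<and> k < i}"
      "l \<notin> {k. k \<in> set ks \<and> k < i}"
      using Cons.prems False by auto
    then show ?thesis
      using Cons False
      by (simp add: jackson_power_other fconst_normalize mult_ac)
  qed
qed simp

section \<open>Ordered monomials span the quotient\<close>

lemma q_proj_swap:
  assumes "i \<in> {1..n}" "j \<in> {1..n}" "p \<in> carrier (free_algebra n)"
  shows "q_proj n q (fvar i * (fvar j * p)) = q_proj n q (fconst (q i j) * (fvar j * (fvar i * p)))"
proof -
  have "fvar i * fvar j - fconst (q i j) * fvar j * fvar i \<in> q_ideal n q"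
    using assms q_relators_subset_ideal by (force simp: q_relators_def)
  then have "(fvar i * fvar j - fconst (q i j) * fvar j * fvar i) * p \<in> q_ideal n q"
    using assms(3) by (rule q_ideal_rmult)
  then show ?thesis using assms
    by (simp add: q_proj_eq_iff free_algebra_mult free_algebra_generators left_diff_distrib mult.assoc
      del: atLeastAtMost_iff One_nat_def)
qed

lemma q_proj_mult_cong:
  assumes "q_proj n q p = q_proj n q r" "p \<in> carrier (free_algebra n)"
    "r \<in> carrier (free_algebra n)" "u \<in> carrier (free_algebra n)"
  shows "q_proj n q (u * p) = q_proj n q (u * r)"
  using assms by (simp add: q_proj_mult)

lemma q_proj_swap_power:
  assumes "i \<in> {1..n}" "j \<in> {1..n}" "p \<in> carrier (free_algebra n)"
  shows "q_proj n q (fvar i * (fvar j ^ m * p)) =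
    q_proj n q (fconst (q i j ^ m) * (fvar j ^ m * (fvar i * p)))"
proof (induction m)
  case (Suc m)
  note [simp] = free_algebra_mult free_algebra_generators fvar_power_closed assms(3)
    assms(1,2)[unfolded One_nat_def]
  have "q_proj n q (fvar i * (fvar j * (fvar j ^ m * p))) =
      q_proj n q (fconst (q i j) * fvar j * (fvar i * (fvar j ^ m * p)))"
    using q_proj_swap[of i n j "fvar j ^ m * p" q] assms
    by (simp add: mult.assoc del: atLeastAtMost_iff)
  also have "\<dots> = q_proj n q (fconst (q i j) * fvar j *
      (fconst (q i j ^ m) * (fvar j ^ m * (fvar i * p))))"
    by (rule q_proj_mult_cong[OF Suc]) (simp_all del: atLeastAtMost_iff)
  finally show ?case
    by (simp add: fconst_normalize mult_ac)
qed simp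

text \<open>The variable x_i moves right through the powers listed before its own, each contributing
  a scalar, and is absorbed there. Spanning only asks that some scalar exists, so its value is not
  recorded.\<close>

lemma q_proj_var_monom:
  assumes "i \<in> set ks" "distinct ks" "set ks \<subseteq> {1..n}"
  shows "\<exists>z. q_proj n q (fvar i * free_monom ks a) =
    q_proj n q (fconst z * free_monom ks (a(i := Suc (a i))))"
  using assms
proof (induction ks)
  case (Cons l ks)
  show ?case
  proof (cases "l = i")
    case True
    then have "free_monom ks (a(i := Suc (a i))) = free_monom ks a"
      using Cons.prems by (intro free_monom_cong) auto
    then have "fvar i * free_monom (l # ks) a =
        fconst 1 * free_monom (l # ks) (a(i := Suc (a i)))"
      using True by (simp add: mult.assoc)
    then show ?thesis by metis
  next
    case False
    have i: "i \<in> {1..n}" and l: "l \<in> {1..n}" and ks: "set ks \<subseteq> {1..n}" using Cons.prems by auto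
    note [simp] = free_algebra_mult free_algebra_generators fvar_power_closed
      free_monom_closed[OF ks] i[unfolded One_nat_def] l[unfolded One_nat_def]
    obtain z where z: "q_proj n q (fvar i * free_monom ks a) =
      q_proj n q (fconst z * free_monom ks (a(i := Suc (a i))))"
      using Cons.IH[OF _ _ ks] Cons.prems False by (metis distinct.simps(2) set_ConsD)
    have "q_proj n q (fvar i * free_monom (l # ks) a) =
        q_proj n q (fconst (q i l ^ a l) * fvar l ^ a l * (fvar i * free_monom ks a))"
      using q_proj_swap_power[OF i l free_monom_closed[OF ks]] by (simp add: mult.assoc)
    also have "\<dots> = q_proj n q (fconst (q i l ^ a l) * fvar l ^ a l *
        (fconst z * free_monom ks (a(i := Suc (a i)))))"
      by (rule q_proj_mult_cong[OF z]) (simp_all del: atLeastAtMost_iff)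
    also have "fconst (q i l ^ a l) * fvar l ^ a l * (fconst z * free_monom ks (a(i := Suc (a i))))
        = fconst (q i l ^ a l * z) * free_monom (l # ks) (a(i := Suc (a i)))"
      using False by (simp add: fconst_normalize)
    finally show ?thesis by blast
  qed
qed simp

text \<open>An inductive description lets two linear operators be compared by rule induction,
  without coefficients or index sets.\<close>

inductive_set monom_span :: "nat \<Rightarrow> (nat \<Rightarrow> nat \<Rightarrow> complex) \<Rightarrow> ncpoly set set"
  for n :: nat and q :: "nat \<Rightarrow> nat \<Rightarrow> complex" where
  monom: "q_monom n q a \<in> monom_span n q"
| add: "f \<in> monom_span n q \<Longrightarrow> g \<in> monom_span n q \<Longrightarrow> f \<oplus>\<^bsub>q_sym n q\<^esub> g \<in> monom_span n q"
| scale: "f \<in> monom_span n q \<Longrightarrow> q_scale n q z f \<in> monom_span n q"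

lemma q_monom_closed: "q_monom n q a \<in> carrier (q_sym n q)"
  unfolding q_monom_eq_proj by (intro q_proj_closed free_monom_closed) auto

lemma q_scale_closed: "f \<in> carrier (q_sym n q) \<Longrightarrow> q_scale n q z f \<in> carrier (q_sym n q)"
  by (auto simp: carrier_q_sym q_proj_scale free_algebra_mult free_algebra_generators)

lemma q_var_closed: "k \<in> {1..n} \<Longrightarrow> q_var n q k \<in> carrier (q_sym n q)"
  by (simp add: q_var_eq_proj q_proj_closed free_algebra_generators del: atLeastAtMost_iff One_nat_def)

lemma q_scale_mult_right:
  assumes "f \<in> carrier (q_sym n q)" "g \<in> carrier (q_sym n q)"
  shows "g \<otimes>\<^bsub>q_sym n q\<^esub> q_scale n q z f = q_scale n q z (g \<otimes>\<^bsub>q_sym n q\<^esub> f)"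
proof -
  obtain p r where "p \<in> carrier (free_algebra n)" "r \<in> carrier (free_algebra n)"
    "f = q_proj n q p" "g = q_proj n q r"
    using assms by (auto simp: carrier_q_sym)
  then show ?thesis
    by (simp add: q_proj_scale free_algebra_mult free_algebra_generators fconst_left_commute
        flip: q_proj_mult)
qed

lemma monom_span_closed: "f \<in> monom_span n q \<Longrightarrow> f \<in> carrier (q_sym n q)"
proof (induction rule: monom_span.induct)
  interpret ring "q_sym n q" by (rule ring_q_sym)
  case (add f g)
  then show ?case by simp
qed (simp_all add: q_monom_closed q_scale_closed)

lemma monom_span_var:
  assumes k: "k \<in> {1..n}" and "f \<in> monom_span n q"
  shows "q_var n q k \<otimes>\<^bsub>q_sym n q\<^esub> f \<in> monom_span n q"
  using assms(2)
proof (induction rule: monom_span.induct)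
  case (monom a)
  have ks: "set [1..<Suc n] \<subseteq> {1..n}" by auto
  obtain z where "q_proj n q (fvar k * free_monom [1..<Suc n] a) =
      q_proj n q (fconst z * free_monom [1..<Suc n] (a(k := Suc (a k))))"
    using q_proj_var_monom[OF _ distinct_upt ks, of k q a] k
    by (metis atLeastAtMost_iff atLeastLessThan_iff less_Suc_eq_le set_upt)
  then have "q_var n q k \<otimes>\<^bsub>q_sym n q\<^esub> q_monom n q a =
      q_scale n q z (q_monom n q (a(k := Suc (a k))))"
    using k free_monom_closed[OF ks]
    by (simp only: q_monom_eq_proj q_var_eq_proj q_proj_scale q_proj_mult free_algebra_generators)
  then show ?case by (simp add: monom_span.monom monom_span.scale)
next
  interpret ring "q_sym n q" by (rule ring_q_sym)
  case (add f g)
  then show ?case using k by (simp only: r_distr monom_span_closed q_var_closed monom_span.add)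
next
  case (scale f z)
  then show ?case using k
    by (simp only: q_scale_mult_right monom_span_closed q_var_closed monom_span.scale)
qed

text \<open>The span contains 1, as the monomial with all exponents 0, and by
  \<open>monom_span_var\<close> it absorbs left multiplication by variables.\<close>

lemma mem_monom_span: "f \<in> carrier (q_sym n q) \<Longrightarrow> f \<in> monom_span n q"
proof (induction rule: q_sym_induct)
  case one
  have "free_monom ks (\<lambda>k. 0) = 1" for ks by (induction ks) simp_all
  then show ?case
    using monom_span.monom[of n q "\<lambda>k. 0"] by (simp only: q_monom_eq_proj q_proj_one)
qed (auto intro: monom_span.intros monom_span_var)

text \<open>This supplies uniqueness in the definite description of
  \<open>braided_deriv\<close>.\<close>

lemma q_linear_eq_on_monoms:
  assumes "q_linear n q M" "q_linear n q N"
    and "\<And>a. M (q_monom n q a) = N (q_monom n q a)" and "f \<in> carrier (q_sym n q)"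
  shows "M f = N f"
  using mem_monom_span[OF assms(4)]
proof (induction rule: monom_span.induct)
  case (add f g)
  then show ?case using assms(1,2) monom_span_closed by (simp add: q_linear_def)
next
  case (scale f z)
  then show ?case using assms(1,2) monom_span_closed by (simp add: q_linear_def)
qed (rule assms)

text \<open>Existence: the descended Jackson derivative at \<open>\<epsilon> = 1\<close> has the
  prescribed values by \<open>jackson_monom\<close>. Uniqueness: ordered monomials span, and
  extensionality settles the arguments outside the carrier.\<close>

lemma (in quantum_parameters) braided_deriv_eq:
  assumes i: "i \<in> {1..n}"
  shows "braided_deriv n q i = descend n q (q_jackson i 1)"
  unfolding braided_deriv_def
proof (rule the_equality)
  let ?D = "descend n q (q_jackson i 1)"
  have ks: "set [1..<Suc n] \<subseteq> {1..n}" by auto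
  have D: "?D (q_monom n q a) =
      q_scale n q (of_nat (a i) * (\<Prod>k \<in> {1..<i}. q k i ^ a k)) (q_monom n q (a(i := a i - 1)))"
    for a
  proof -
    have set_eq: "{k. k \<in> set [1..<Suc n] \<and> k < i} = {1..<i}" using i by auto
    have "i \<in> set [1..<Suc n]" using i by auto
    then have "q_jackson i 1 (free_monom [1..<Suc n] a) =
        fconst (of_nat (a i) * (\<Prod>k \<in> {1..<i}. q k i ^ a k)) *
          free_monom [1..<Suc n] (a(i := a i - 1))"
      using jackson_monom[of "\<lambda>k. q k i", OF q_diag[OF i] _ sorted_wrt_upt, of 1 "Suc n" a]
      by (simp only: set_eq)
    then show ?thesis
      using free_monom_closed[OF ks] i
      by (simp only: q_monom_eq_proj descend_proj[OF descends_jackson] q_proj_scale)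
  qed
  have ext: "?D \<in> extensional (carrier (q_sym n q))" by (rule descend_extensional)
  have lin: "q_linear n q ?D" by (rule q_linear_descend[OF descends_jackson[OF i]])
  show "?D \<in> extensional (carrier (q_sym n q)) \<and> q_linear n q ?D \<and>
      (\<forall>a. ?D (q_monom n q a) =
        q_scale n q (of_nat (a i) * (\<Prod>k \<in> {1..<i}. q k i ^ a k)) (q_monom n q (a(i := a i - 1))))"
    by (intro conjI allI ext lin D)
  fix D'
  assume D': "D' \<in> extensional (carrier (q_sym n q)) \<and> q_linear n q D' \<and>
      (\<forall>a. D' (q_monom n q a) =
        q_scale n q (of_nat (a i) * (\<Prod>k \<in> {1..<i}. q k i ^ a k)) (q_monom n q (a(i := a i - 1))))"
  then have D'_monom: "D' (q_monom n q a) = ?D (q_monom n q a)" for a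
    unfolding D by blast
  show "D' = ?D"
  proof (rule extensionalityI)
    show "D' \<in> extensional (carrier (q_sym n q))" using D' by (rule conjunct1)
    show "D' f = ?D f" if "f \<in> carrier (q_sym n q)" for f
      using D'[THEN conjunct2, THEN conjunct1] lin D'_monom that by (rule q_linear_eq_on_monoms)
  qed (rule ext)
qed

section \<open>Twists and divided differences\<close>

lemma descend_ring_hom: "descend n q (scale_vars \<chi>) \<in> ring_hom (q_sym n q) (q_sym n q)"
  by (rule ring_hom_memI)
    (auto simp: carrier_q_sym descend_proj descends_scale_vars scale_vars_closed scale_vars_mult
      scale_vars.add scale_vars_one free_algebra_add free_algebra_mult free_algebra_generators
      simp flip: q_proj_add q_proj_mult q_proj_one)

lemma descend_scale_vars_inverse:
  assumes "\<And>k. \<chi> k * \<psi> k = 1" "f \<in> carrier (q_sym n q)"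
  shows "descend n q (scale_vars \<chi>) (descend n q (scale_vars \<psi>) f) = f"
  using assms
  by (auto simp: carrier_q_sym descend_proj descends_scale_vars scale_vars_closed
      scale_vars_scale_vars scale_vars_id)

text \<open>The inverse is the diagonal map with the reciprocal factors.\<close>

lemma descend_ring_iso:
  assumes "\<And>k. \<chi> k \<noteq> 0"
  shows "descend n q (scale_vars \<chi>) \<in> ring_iso (q_sym n q) (q_sym n q)"
proof -
  have "bij_betw (descend n q (scale_vars \<chi>)) (carrier (q_sym n q)) (carrier (q_sym n q))"
    by (rule bij_betw_byWitness[where f' = "descend n q (scale_vars (\<lambda>k. inverse (\<chi> k)))"])
      (use assms in \<open>auto simp: descend_scale_vars_inverse
        intro: ring_hom_closed[OF descend_ring_hom]\<close>)
  then show ?thesis by (simp add: ring_iso_def descend_ring_hom)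
qed

text \<open>The condition \<open>\<epsilon> \<noteq> 0\<close> makes the diagonal map bijective.
  Uniqueness holds because a linear ring homomorphism is determined by its values on the
  variables.\<close>

lemma q_twist_eq:
  assumes "\<epsilon> \<noteq> 0"
  shows "q_twist n q i \<epsilon> = descend n q (twist i \<epsilon>)"
  unfolding q_twist_def
proof (rule the_equality)
  let ?t = "descend n q (twist i \<epsilon>)"
  have ext: "?t \<in> extensional (carrier (q_sym n q))" by (rule descend_extensional)
  have iso: "?t \<in> ring_iso (q_sym n q) (q_sym n q)"
    using assms by (intro descend_ring_iso) simp
  have lin: "q_linear n q ?t" by (rule q_linear_descend[OF descends_scale_vars])
  have var: "\<forall>k \<in> {1..n}. ?t (q_var n q k) =
      (if k = i then q_scale n q \<epsilon> (q_var n q k) else q_var n q k)"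
    by (simp add: q_var_eq_proj descend_proj descends_scale_vars free_algebra_generators
        scale_vars_fvar q_proj_scale del: atLeastAtMost_iff One_nat_def)
  show "?t \<in> extensional (carrier (q_sym n q)) \<and>
     ?t \<in> ring_iso (q_sym n q) (q_sym n q) \<and> q_linear n q ?t \<and>
     (\<forall>k \<in> {1..n}. ?t (q_var n q k) =
        (if k = i then q_scale n q \<epsilon> (q_var n q k) else q_var n q k))"
    by (intro conjI ext iso lin var)
  fix t
  assume t: "t \<in> extensional (carrier (q_sym n q)) \<and>
     t \<in> ring_iso (q_sym n q) (q_sym n q) \<and> q_linear n q t \<and>
     (\<forall>k \<in> {1..n}. t (q_var n q k) =
        (if k = i then q_scale n q \<epsilon> (q_var n q k) else q_var n q k))"
  show "t = ?t"
  proof (rule extensionalityI[OF _ ext])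
    show "t \<in> extensional (carrier (q_sym n q))" using t by (rule conjunct1)
    have t_iso: "t \<in> ring_iso (q_sym n q) (q_sym n q)" and t_lin: "q_linear n q t" using t by blast+
    have t_var: "t (q_var n q k) = ?t (q_var n q k)" if "k \<in> {1..n}" for k
      using t[THEN conjunct2, THEN conjunct2, THEN conjunct2, THEN bspec, OF that]
        bspec[OF var that, symmetric] by (rule trans)
    show "t f = ?t f" if "f \<in> carrier (q_sym n q)" for f
      using that
    proof (induction rule: q_sym_induct)
      case (add f g)
      then show ?case using t_lin lin unfolding q_linear_def by metis
    next
      case (scale z f)
      then show ?case using t_lin lin unfolding q_linear_def by metis
    next
      case one
      show ?case by (simp only: ring_iso_memE(4)[OF t_iso] ring_iso_memE(4)[OF iso])
    next
      case (var k f)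
      then show ?case
        by (simp only: ring_iso_memE(2)[OF t_iso q_var_closed[OF var(1)] var(2)]
            ring_iso_memE(2)[OF iso q_var_closed[OF var(1)] var(2)] t_var)
    qed
  qed
qed

section \<open>Division of 1 - t_i by x_i\<close>

context quantum_parameters
begin

text \<open>This identifies the Jackson derivative with the divided difference, written without
  inverses. It is stated in the quotient because x_i has to be moved past the first letter x_k; the
  swap costs \<open>q i k\<close>, which cancels the weight \<open>q k i\<close> from the
  recursion.\<close>

lemma jackson_divides:
  assumes i: "i \<in> {1..n}" and "p \<in> carrier (free_algebra n)"
  shows "q_proj n q (fvar i * (fconst (1 - \<epsilon>) * q_jackson i \<epsilon> p)) = q_proj n q (p - twist i \<epsilon> p)"
  using assms(2)
proof (induction p rule: free_algebra_induct)
  case (add p r)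
  then show ?case using i
    by (simp add: jackson.add scale_vars.add distrib_left add_diff_add q_proj_add scale_vars_closed
        jackson_closed free_algebra_mult free_algebra_diff free_algebra_add free_algebra_generators
        del: atLeastAtMost_iff One_nat_def)
next
  case (scale z p)
  have "q_proj n q (fconst z * (fvar i * (fconst (1 - \<epsilon>) * q_jackson i \<epsilon> p))) =
      q_proj n q (fconst z * (p - twist i \<epsilon> p))"
    by (rule q_proj_mult_cong[OF scale(2)])
      (use scale(1) i in \<open>simp_all add: scale_vars_closed jackson_closed free_algebra_mult
        free_algebra_diff free_algebra_generators del: atLeastAtMost_iff One_nat_def\<close>)
  then show ?case
    by (simp add: jackson.scale scale_vars.scale right_diff_distrib fconst_normalize mult_ac)
next
  case one
  show ?case by (simp add: jackson_one scale_vars_one)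
next
  case (var k p)
  note closed = scale_vars_closed jackson_closed free_algebra_mult free_algebra_diff
    free_algebra_add free_algebra_generators
  have IH: "q_proj n q (fvar k * (fvar i * (fconst (1 - \<epsilon>) * q_jackson i \<epsilon> p))) =
      q_proj n q (fvar k * (p - twist i \<epsilon> p))"
    by (rule q_proj_mult_cong[OF var(3)])
      (use var(1,2) i in \<open>simp_all add: closed del: atLeastAtMost_iff One_nat_def\<close>)
  show ?case
  proof (cases "k = i")
    case True
    have "q_proj n q (fvar i * (fconst (1 - \<epsilon>) * q_jackson i \<epsilon> (fvar i * p))) =
        q_proj n q (fvar i * (fvar i * (fconst (1 - \<epsilon>) * q_jackson i \<epsilon> p)) +
          fvar i * (fconst (1 - \<epsilon>) * twist i \<epsilon> p))"
      using q_diag[OF i] by (simp add: jackson_var distrib_left fconst_normalize)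
    also have "\<dots> = q_proj n q (fvar i * (p - twist i \<epsilon> p) + fvar i * (fconst (1 - \<epsilon>) * twist i \<epsilon> p))"
      using IH[unfolded True] var(2) i
      by (simp add: q_proj_add closed del: atLeastAtMost_iff One_nat_def)
    \<comment> \<open>The two copies of the twisted \<open>p\<close> combine to coefficient
      -\<epsilon>, the factor that the twist puts on the letter x_i.\<close>
    also have "fvar i * (p - twist i \<epsilon> p) + fvar i * (fconst (1 - \<epsilon>) * twist i \<epsilon> p) =
        fvar i * p - twist i \<epsilon> (fvar i * p)"
      by (simp add: scale_vars_var fconst_diff algebra_simps fconst_left_commute)
    finally show ?thesis using True by simp
  next
    case False
    have "q_proj n q (fvar i * (fconst (1 - \<epsilon>) * q_jackson i \<epsilon> (fvar k * p))) =
        q_proj n q (fconst (q k i * (1 - \<epsilon>)) * (fvar i * (fvar k * q_jackson i \<epsilon> p)))"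
      using False by (simp add: jackson_var fconst_normalize mult.commute)
    also have "\<dots> = q_proj n q (fconst (q k i * (1 - \<epsilon>)) *
        (fconst (q i k) * (fvar k * (fvar i * q_jackson i \<epsilon> p))))"
      by (rule q_proj_mult_cong[OF q_proj_swap])
        (use var(1,2) i in \<open>simp_all add: closed del: atLeastAtMost_iff One_nat_def\<close>)
    also have "fconst (q k i * (1 - \<epsilon>)) * (fconst (q i k) * (fvar k * (fvar i * q_jackson i \<epsilon> p))) =
        fconst (q k i * q i k) * (fvar k * (fvar i * (fconst (1 - \<epsilon>) * q_jackson i \<epsilon> p)))"
      by (simp add: fconst_normalize mult_ac)
    also have "q_proj n q \<dots> = q_proj n q (fvar k * (p - twist i \<epsilon> p))"
      using IH q_inv[OF var(1) i] by simp
    also have "fvar k * (p - twist i \<epsilon> p) = fvar k * p - twist i \<epsilon> (fvar k * p)"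
      using False by (simp add: scale_vars_var right_diff_distrib)
    finally show ?thesis .
  qed
qed

text \<open>Required to invert x_i in the skew field: if x_i were in the ideal, so would be its
  derivative 1.\<close>

lemma q_var_nonzero:
  assumes i: "i \<in> {1..n}" and "\<one>\<^bsub>q_sym n q\<^esub> \<noteq> \<zero>\<^bsub>q_sym n q\<^esub>"
  shows "q_var n q i \<noteq> \<zero>\<^bsub>q_sym n q\<^esub>"
proof
  assume "q_var n q i = \<zero>\<^bsub>q_sym n q\<^esub>"
  then have "fvar i \<in> q_ideal n q"
    using i by (simp only: q_var_eq_proj q_proj_eq_zero_iff free_algebra_generators)
  then have "q_jackson i 1 (fvar i) \<in> q_ideal n q" using i by (rule jackson_ideal)
  then have "q_proj n q 1 = \<zero>\<^bsub>q_sym n q\<^esub>"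
    by (simp add: jackson_fvar q_proj_eq_zero_iff free_algebra_generators)
  then show False using assms(2) by (simp add: q_proj_one)
qed

text \<open>By \<open>jackson_divides\<close> the argument is x_i times \<open>?g\<close>. In
  \<open>K\<close> the inverse of x_i cancels, and injectivity of \<open>\<iota>\<close> lets
  \<open>inv_into\<close> recover \<open>?g\<close>.\<close>

lemma q_divdiff_proj:
  assumes K: "skew_field_of_fractions (q_sym n q) K \<iota>"
    and i: "i \<in> {1..n}" and "\<epsilon> \<noteq> 0" and p: "p \<in> carrier (free_algebra n)"
  shows "q_divdiff n q K \<iota> i \<epsilon> (q_proj n q p) = q_proj n q (fconst (1 - \<epsilon>) * q_jackson i \<epsilon> p)"
proof -
  interpret K: ring K using K by (simp add: skew_field_of_fractions_def)
  have units: "Units K = carrier K - {\<zero>\<^bsub>K\<^esub>}" and hom: "\<iota> \<in> ring_hom (q_sym n q) K"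
    and inj: "inj_on \<iota> (carrier (q_sym n q))"
    using K by (simp_all add: skew_field_of_fractions_def)
  interpret S: ring "q_sym n q" by (rule ring_q_sym)
  have iota_zero: "\<iota> \<zero>\<^bsub>q_sym n q\<^esub> = \<zero>\<^bsub>K\<^esub>"
    by (rule ring_hom_zero[OF hom ring_q_sym K.ring_axioms])
  \<comment> \<open>Nontriviality passes from \<open>K\<close>, where 1 is a unit and hence nonzero,
    back to the quotient.\<close>
  have "\<one>\<^bsub>K\<^esub> \<noteq> \<zero>\<^bsub>K\<^esub>" using units K.Units_one_closed by auto
  then have "\<one>\<^bsub>q_sym n q\<^esub> \<noteq> \<zero>\<^bsub>q_sym n q\<^esub>"
    using iota_zero ring_hom_one[OF hom] by auto
  then have "q_var n q i \<noteq> \<zero>\<^bsub>q_sym n q\<^esub>" by (rule q_var_nonzero[OF i])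
  then have "\<iota> (q_var n q i) \<noteq> \<zero>\<^bsub>K\<^esub>"
    using inj_onD[OF inj] iota_zero q_var_closed[OF i] S.zero_closed by metis
  then have unit: "\<iota> (q_var n q i) \<in> Units K"
    using units ring_hom_closed[OF hom q_var_closed[OF i]] by simp
  let ?g = "q_proj n q (fconst (1 - \<epsilon>) * q_jackson i \<epsilon> p)"
  have g: "?g \<in> carrier (q_sym n q)"
    using p by (simp add: q_proj_closed jackson_closed free_algebra_mult free_algebra_generators)
  have "q_proj n q p \<ominus>\<^bsub>q_sym n q\<^esub> q_twist n q i \<epsilon> (q_proj n q p) = q_proj n q (p - twist i \<epsilon> p)"
    using \<open>\<epsilon> \<noteq> 0\<close> p
    by (simp add: q_twist_eq descend_proj descends_scale_vars q_proj_diff scale_vars_closed)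
  also have "\<dots> = q_proj n q (fvar i * (fconst (1 - \<epsilon>) * q_jackson i \<epsilon> p))"
    by (rule jackson_divides[OF i p, symmetric])
  also have "\<dots> = q_var n q i \<otimes>\<^bsub>q_sym n q\<^esub> ?g"
    using i p by (simp add: q_proj_mult q_var_eq_proj jackson_closed free_algebra_mult
        free_algebra_generators del: atLeastAtMost_iff One_nat_def)
  finally have "inv\<^bsub>K\<^esub> \<iota> (q_var n q i) \<otimes>\<^bsub>K\<^esub>
      \<iota> (q_proj n q p \<ominus>\<^bsub>q_sym n q\<^esub> q_twist n q i \<epsilon> (q_proj n q p)) =
    inv\<^bsub>K\<^esub> \<iota> (q_var n q i) \<otimes>\<^bsub>K\<^esub> (\<iota> (q_var n q i) \<otimes>\<^bsub>K\<^esub> \<iota> ?g)"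
    using ring_hom_mult[OF hom q_var_closed[OF i] g] by simp
  also have "\<dots> = \<iota> ?g"
    using unit ring_hom_closed[OF hom g] K.Units_closed[OF unit] K.Units_inv_closed[OF unit]
    by (simp add: K.Units_l_inv flip: K.m_assoc)
  finally show ?thesis
    using inv_into_f_f[OF inj g] by (simp add: q_divdiff_def)
qed

end

section \<open>Braided Dunkl operators\<close>

lemma (in ncpoly_linear) sum: "L (\<Sum>x\<in>X. g x) = (\<Sum>x\<in>X. L (g x))"
  by (induction X rule: infinite_finite_induct) (simp_all add: zero add)

context quantum_parameters
begin

text \<open>The summand for \<open>\<epsilon> = 1\<close> is the braided partial derivative.\<close>

definition free_nabla :: "complex set \<Rightarrow> (complex \<Rightarrow> complex) \<Rightarrow> nat \<Rightarrow> ncpoly \<Rightarrow> ncpoly" where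
  "free_nabla E w i p = (\<Sum>\<epsilon>\<in>E. fconst (w \<epsilon>) * q_jackson i \<epsilon> p)"

lemma free_nabla_closed:
  assumes "finite E" "p \<in> carrier (free_algebra n)"
  shows "free_nabla E w i p \<in> carrier (free_algebra n)"
  unfolding free_nabla_def
  using q_proj_sum[OF assms(1), of "\<lambda>\<epsilon>. fconst (w \<epsilon>) * q_jackson i \<epsilon> p" n]
  by (simp add: assms(2) jackson_closed free_algebra_mult free_algebra_generators)

lemma free_nabla_var:
  "free_nabla E w i (fvar j * p) = fconst (q j i) * (fvar j * free_nabla E w i p) +
    (if i = j then \<Sum>\<epsilon>\<in>E. fconst (w \<epsilon>) * twist i \<epsilon> p else 0)"
  by (auto simp: free_nabla_def jackson_var distrib_left sum_distrib_left sum.distrib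
      fconst_mult_fconst fconst_left_commute mult.commute)

text \<open>Expanding both sums leaves pairs of Jackson derivatives, and
  \<open>jackson_jackson\<close> gives each pair the same factor \<open>q i j\<close>.\<close>

lemma free_nabla_commute:
  assumes "i \<in> {1..n}" "j \<in> {1..n}" "i \<noteq> j"
  shows "free_nabla E w i (free_nabla F v j p) =
    fconst (q i j) * free_nabla F v j (free_nabla E w i p)"
proof -
  have "free_nabla E w i (free_nabla F v j p) =
      (\<Sum>\<epsilon>\<in>E. \<Sum>\<eta>\<in>F. fconst (w \<epsilon> * v \<eta>) * q_jackson i \<epsilon> (q_jackson j \<eta> p))"
    by (simp add: free_nabla_def jackson.sum jackson.scale sum_distrib_left fconst_mult_fconst)
  also have "\<dots> = (\<Sum>\<eta>\<in>F. \<Sum>\<epsilon>\<in>E. fconst (w \<epsilon> * v \<eta>) * q_jackson i \<epsilon> (q_jackson j \<eta> p))"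
    by (rule sum.swap)
  also have "\<dots> = (\<Sum>\<eta>\<in>F. \<Sum>\<epsilon>\<in>E. fconst (q i j * (v \<eta> * w \<epsilon>)) * q_jackson j \<eta> (q_jackson i \<epsilon> p))"
    by (simp add: jackson_jackson[where q = q, OF q_inv[OF assms(1,2)] assms(3)]
        fconst_mult_fconst mult_ac)
  also have "\<dots> = fconst (q i j) * free_nabla F v j (free_nabla E w i p)"
    by (simp add: free_nabla_def jackson.sum jackson.scale sum_distrib_left fconst_mult_fconst)
  finally show ?thesis .
qed

text \<open>The factor \<open>1 - \<epsilon>\<close> from \<open>q_divdiff_proj\<close> cancels the
  denominator, leaving weight \<open>c i \<epsilon>\<close>. The update at 1 gives the braided
  derivative, the summand with \<epsilon> = 1, weight 1.\<close>

lemma braided_nabla_proj: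
  assumes K: "skew_field_of_fractions (q_sym n q) K \<iota>" and i: "i \<in> {1..n}"
    and C: "finite (C i)" "0 \<notin> C i" and p: "p \<in> carrier (free_algebra n)"
  shows "braided_nabla n q K \<iota> C c i (q_proj n q p) =
    q_proj n q (free_nabla (insert 1 (C i)) ((c i)(1 := 1)) i p)"
proof -
  interpret S: ring "q_sym n q" by (rule ring_q_sym)
  let ?g = "\<lambda>\<epsilon>. fconst (c i \<epsilon>) * q_jackson i \<epsilon> p"
  have g: "?g \<epsilon> \<in> carrier (free_algebra n)" for \<epsilon>
    using p by (simp add: jackson_closed free_algebra_mult free_algebra_generators)
  have "q_scale n q (c i \<epsilon> / (1 - \<epsilon>)) (q_divdiff n q K \<iota> i \<epsilon> (q_proj n q p)) =
      q_proj n q (?g \<epsilon>)" if "\<epsilon> \<in> C i - {1}" for \<epsilon>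
  proof -
    have "\<epsilon> \<noteq> 0" "\<epsilon> \<noteq> 1" using that C(2) by auto
    then show ?thesis
      using p by (simp add: q_divdiff_proj[OF K i] q_proj_scale jackson_closed free_algebra_mult
          free_algebra_generators fconst_mult_fconst)
  qed
  then have "(\<Oplus>\<^bsub>q_sym n q\<^esub> \<epsilon> \<in> C i - {1}.
      q_scale n q (c i \<epsilon> / (1 - \<epsilon>)) (q_divdiff n q K \<iota> i \<epsilon> (q_proj n q p))) =
    (\<Oplus>\<^bsub>q_sym n q\<^esub> \<epsilon> \<in> C i - {1}. q_proj n q (?g \<epsilon>))"
    using g by (intro S.finsum_cong') (auto simp: q_proj_closed)
  also have "\<dots> = q_proj n q (\<Sum>\<epsilon>\<in>C i - {1}. ?g \<epsilon>)"
    using q_proj_sum[of "C i - {1}" ?g n q] C(1) g by simp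
  finally have "braided_nabla n q K \<iota> C c i (q_proj n q p) =
      q_proj n q (q_jackson i 1 p) \<oplus>\<^bsub>q_sym n q\<^esub> q_proj n q (\<Sum>\<epsilon>\<in>C i - {1}. ?g \<epsilon>)"
    unfolding braided_nabla_def
    by (simp only: braided_deriv_eq[OF i] descend_proj[OF descends_jackson[OF i] p])
  also have "\<dots> = q_proj n q (q_jackson i 1 p + (\<Sum>\<epsilon>\<in>C i - {1}. ?g \<epsilon>))"
    using q_proj_sum[of "C i - {1}" ?g n q] C(1) g p by (simp add: q_proj_add jackson_closed)
  also have "q_jackson i 1 p + (\<Sum>\<epsilon>\<in>C i - {1}. ?g \<epsilon>) =
      free_nabla (insert 1 (C i)) ((c i)(1 := 1)) i p"
    using C(1) by (simp add: free_nabla_def sum.insert_remove)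
  finally show ?thesis .
qed

lemma braided_nabla_closed:
  assumes "skew_field_of_fractions (q_sym n q) K \<iota>" "i \<in> {1..n}" "finite (C i)" "0 \<notin> C i"
  shows "braided_nabla n q K \<iota> C c i \<in> carrier (q_sym n q) \<rightarrow> carrier (q_sym n q)"
  using assms(3)
  by (auto simp: carrier_q_sym braided_nabla_proj[where K = K and C = C, OF assms] free_nabla_closed)

lemma braided_nabla_var:
  assumes K: "skew_field_of_fractions (q_sym n q) K \<iota>" and i: "i \<in> {1..n}" and j: "j \<in> {1..n}"
    and C: "finite (C i)" "0 \<notin> C i" and f: "f \<in> carrier (q_sym n q)"
  shows "braided_nabla n q K \<iota> C c i (q_var n q j \<otimes>\<^bsub>q_sym n q\<^esub> f) \<ominus>\<^bsub>q_sym n q\<^esub>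
      q_scale n q (q j i) (q_var n q j \<otimes>\<^bsub>q_sym n q\<^esub> braided_nabla n q K \<iota> C c i f) =
    (if i = j
     then f \<oplus>\<^bsub>q_sym n q\<^esub>
       (\<Oplus>\<^bsub>q_sym n q\<^esub> \<epsilon> \<in> C i - {1}. q_scale n q (c i \<epsilon>) (q_twist n q i \<epsilon> f))
     else \<zero>\<^bsub>q_sym n q\<^esub>)"
proof -
  interpret S: ring "q_sym n q" by (rule ring_q_sym)
  obtain p where p: "p \<in> carrier (free_algebra n)" and f_eq: "f = q_proj n q p"
    using f by (auto simp: carrier_q_sym)
  let ?N = "free_nabla (insert 1 (C i)) ((c i)(1 := 1)) i"
  note nabla = braided_nabla_proj[where K = K and C = C, OF K i C]
  have jp: "fvar j * p \<in> carrier (free_algebra n)"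
    using j p by (rule free_algebra_mult[OF free_algebra_generators(4)])
  have closed: "?N r \<in> carrier (free_algebra n)" if "r \<in> carrier (free_algebra n)" for r
    using C(1) that by (simp add: free_nabla_closed)
  have jN: "fvar j * ?N p \<in> carrier (free_algebra n)"
    using j closed[OF p] by (rule free_algebra_mult[OF free_algebra_generators(4)])
  have "braided_nabla n q K \<iota> C c i (q_var n q j \<otimes>\<^bsub>q_sym n q\<^esub> f) \<ominus>\<^bsub>q_sym n q\<^esub>
      q_scale n q (q j i) (q_var n q j \<otimes>\<^bsub>q_sym n q\<^esub> braided_nabla n q K \<iota> C c i f) =
    q_proj n q (?N (fvar j * p)) \<ominus>\<^bsub>q_sym n q\<^esub> q_proj n q (fconst (q j i) * (fvar j * ?N p))"
    unfolding f_eq q_var_eq_proj nabla[OF p]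
    by (simp only: nabla[OF jp] q_proj_scale[OF jN] free_algebra_generators(4)[OF j] p closed[OF p]
        flip: q_proj_mult)
  also have "\<dots> = q_proj n q (?N (fvar j * p) - fconst (q j i) * (fvar j * ?N p))"
    by (rule q_proj_diff[symmetric])
      (intro closed jp free_algebra_mult[OF free_algebra_generators(3) jN])+
  \<comment> \<open>The summand with \<epsilon> = 1 has weight 1 and trivial twist; it yields the
    identity term \<open>p\<close>.\<close>
  also have "?N (fvar j * p) - fconst (q j i) * (fvar j * ?N p) =
      (if i = j then p + (\<Sum>\<epsilon>\<in>C i - {1}. fconst (c i \<epsilon>) * twist i \<epsilon> p) else 0)"
    using C(1) by (cases "i = j") (simp_all add: free_nabla_var sum.insert_remove scale_vars_id)
  finally have main: "braided_nabla n q K \<iota> C c i (q_var n q j \<otimes>\<^bsub>q_sym n q\<^esub> f) \<ominus>\<^bsub>q_sym n q\<^esub>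
      q_scale n q (q j i) (q_var n q j \<otimes>\<^bsub>q_sym n q\<^esub> braided_nabla n q K \<iota> C c i f) =
    q_proj n q (if i = j then p + (\<Sum>\<epsilon>\<in>C i - {1}. fconst (c i \<epsilon>) * twist i \<epsilon> p) else 0)" .
  let ?h = "\<lambda>\<epsilon>. fconst (c i \<epsilon>) * twist i \<epsilon> p"
  have h: "?h \<epsilon> \<in> carrier (free_algebra n)" for \<epsilon>
    using p by (simp add: scale_vars_closed free_algebra_mult free_algebra_generators)
  have scale: "q_scale n q (c i \<epsilon>) (q_twist n q i \<epsilon> f) = q_proj n q (?h \<epsilon>)" if "\<epsilon> \<in> C i - {1}" for \<epsilon>
  proof -
    have "\<epsilon> \<noteq> 0" using that C(2) by auto
    then show ?thesis
      using p by (simp add: f_eq q_twist_eq descend_proj descends_scale_vars q_proj_scale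
          scale_vars_closed)
  qed
  have "(\<Oplus>\<^bsub>q_sym n q\<^esub> \<epsilon> \<in> C i - {1}. q_scale n q (c i \<epsilon>) (q_twist n q i \<epsilon> f)) =
      (\<Oplus>\<^bsub>q_sym n q\<^esub> \<epsilon> \<in> C i - {1}. q_proj n q (?h \<epsilon>))"
    using h scale by (intro S.finsum_cong') (auto simp: q_proj_closed)
  also have "\<dots> = q_proj n q (\<Sum>\<epsilon>\<in>C i - {1}. ?h \<epsilon>)"
    using q_proj_sum[of "C i - {1}" ?h n q] C(1) h by simp
  finally have rhs: "(\<Oplus>\<^bsub>q_sym n q\<^esub> \<epsilon> \<in> C i - {1}. q_scale n q (c i \<epsilon>) (q_twist n q i \<epsilon> f)) =
      q_proj n q (\<Sum>\<epsilon>\<in>C i - {1}. ?h \<epsilon>)" .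
  have "(\<Sum>\<epsilon>\<in>C i - {1}. ?h \<epsilon>) \<in> carrier (free_algebra n)"
    using q_proj_sum[of "C i - {1}" ?h n q] C(1) h by simp
  then show ?thesis
    unfolding main rhs unfolding f_eq using p by (cases "i = j") (simp_all add: q_proj_add q_proj_zero)
qed

lemma braided_nabla_commute:
  assumes K: "skew_field_of_fractions (q_sym n q) K \<iota>" and i: "i \<in> {1..n}" and j: "j \<in> {1..n}"
    and C: "finite (C i)" "0 \<notin> C i" "finite (C j)" "0 \<notin> C j" and f: "f \<in> carrier (q_sym n q)"
  shows "braided_nabla n q K \<iota> C c i (braided_nabla n q K \<iota> C c j f) =
    q_scale n q (q i j) (braided_nabla n q K \<iota> C c j (braided_nabla n q K \<iota> C c i f))"
proof -
  obtain p where p: "p \<in> carrier (free_algebra n)" and f_eq: "f = q_proj n q p"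
    using f by (auto simp: carrier_q_sym)
  let ?N = "\<lambda>i. free_nabla (insert 1 (C i)) ((c i)(1 := 1)) i"
  note nabla = braided_nabla_proj[where K = K and C = C, OF K i C(1,2)]
    braided_nabla_proj[where K = K and C = C, OF K j C(3,4)]
  have closed: "?N i r \<in> carrier (free_algebra n)" "?N j r \<in> carrier (free_algebra n)"
    if "r \<in> carrier (free_algebra n)" for r
    using C that by (simp_all add: free_nabla_closed)
  have "?N i (?N j p) = fconst (q i j) * ?N j (?N i p)"
  proof (cases "i = j")
    \<comment> \<open>The operator commutes with itself, and the factor is
      \<open>q i i = 1\<close>.\<close>
    case True
    then show ?thesis using q_diag[OF i] by simp
  qed (rule free_nabla_commute[OF i j])
  then show ?thesis
    by (simp only: f_eq nabla p closed q_proj_scale)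
qed

end

theorem proposition0p8:
  fixes n :: nat and q :: "nat \<Rightarrow> nat \<Rightarrow> complex"
    and C :: "nat \<Rightarrow> complex set" and c :: "nat \<Rightarrow> complex \<Rightarrow> complex"
    and K :: "'k ring" and \<iota> :: "ncpoly set \<Rightarrow> 'k"
  assumes q_diag: "\<And>i. i \<in> {1..n} \<Longrightarrow> q i i = 1"
    and q_inv: "\<And>i j. i \<in> {1..n} \<Longrightarrow> j \<in> {1..n} \<Longrightarrow> q i j * q j i = 1"
    and C_subgroup: "\<And>i. i \<in> {1..n} \<Longrightarrow> subgroup (C i) complex_units"
    and C_finite: "\<And>i. i \<in> {1..n} \<Longrightarrow> finite (C i)"
    and K_fractions: "skew_field_of_fractions (q_sym n q) K \<iota>"
  shows "(\<forall>i \<in> {1..n}. braided_nabla n q K \<iota> C c i \<in> carrier (q_sym n q) \<rightarrow> carrier (q_sym n q)) \<and>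
    (\<forall>i \<in> {1..n}. \<forall>j \<in> {1..n}. \<forall>f \<in> carrier (q_sym n q).
      braided_nabla n q K \<iota> C c i (q_var n q j \<otimes>\<^bsub>q_sym n q\<^esub> f) \<ominus>\<^bsub>q_sym n q\<^esub>
        q_scale n q (q j i) (q_var n q j \<otimes>\<^bsub>q_sym n q\<^esub> braided_nabla n q K \<iota> C c i f) =
      (if i = j
       then f \<oplus>\<^bsub>q_sym n q\<^esub>
         (\<Oplus>\<^bsub>q_sym n q\<^esub> \<epsilon> \<in> C i - {1}. q_scale n q (c i \<epsilon>) (q_twist n q i \<epsilon> f))
       else \<zero>\<^bsub>q_sym n q\<^esub>)) \<and>
    (\<forall>i \<in> {1..n}. \<forall>j \<in> {1..n}. \<forall>f \<in> carrier (q_sym n q).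
      braided_nabla n q K \<iota> C c i (braided_nabla n q K \<iota> C c j f) =
      q_scale n q (q i j) (braided_nabla n q K \<iota> C c j (braided_nabla n q K \<iota> C c i f)))"
proof -
  interpret quantum_parameters n q
    by unfold_locales (rule q_diag q_inv; assumption)+
  \<comment> \<open>A subgroup of the nonzero complex numbers avoids 0, so every twist that occurs
    is invertible.\<close>
  have C: "finite (C i)" "0 \<notin> C i" if "i \<in> {1..n}" for i
    using C_finite[OF that] subgroup.subset[OF C_subgroup[OF that]]
    by (auto simp: complex_units_def)
  show ?thesis
    by (intro conjI ballI braided_nabla_closed braided_nabla_var braided_nabla_commute
        K_fractions C)
qed

end
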